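(* Let $f_a(X)=X^3+aX+a$ and $F_m(X,Y)=X^3-2mX^2Y-9mXY^2-m(2m+27)Y^3$. For $m\in\mathbb{Z}\setminus\{0\}$, call a pair $(x,y)\in\mathbb{Z}^2$ an admissible solution for $m$ if $\gcd(x,y)=1$, $(x,y)\neq(-1,0)$, $y\geq 0$, and $\lambda:=F_m(x,y)$ is an integer such that $\lambda^2$ divides $m^3(4m+27)^5$. Say that an admissible solution $(x,y)$ satisfies condition (C) with respect to $m,n$ if \[ n=m+\frac{m(4m+27)\,y\,(x^2+9xy+27y^2+my^2)(x^3-mx^2y-m^2y^3)}{F_m(x,y)^2}. \] Let $m,n\in\mathbb{Z}\setminus\{0\}$ and assume that the splitting fields of $f_m(X)$ and of $f_n(X)$ over $\mathbb{Q}$ coincide. Then: (i) If $\mathrm{Gal}_\mathbb{Q} f_m(X)\cong S_3$, then there exists exactly one admissible solution for $m$ satisfying condition (C) with respect to $m,n$. In particular, for $m=n$ this solution is $(1,0)$. (ii) If $\mathrm{Gal}_\mathbb{Q} f_m(X)\cong C_3$, then $m=-b^2-b-7$ for some $b\in\mathbb{Z}$, and there are exactly three admissible solutions for $m$ satisfying condition (C) with respect to $m,n$. In particular, for $m=n$ these solutions are $(1,0)$, $(b-4,1)$, $(-b-5,1)$, with $F_m(x,y)=1,\,-(2b+1)^3,\,(2b+1)^3$ respectively. (iii) If $\mathrm{Gal}_\mathbb{Q} f_m(X)\cong C_2$, then $m=n=-8$, and the admissible solutions for $m$ satisfying condition (C) are $(1,0)$ and $(-4,1)$, with $F_m(x,y)=1,\,-8$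 respectively.
   Context: $\mathrm{Gal}_\mathbb{Q} f(X)$ denotes the Galois group of the splitting field of $f(X)$ over $\mathbb{Q}$; $S_3$ is the symmetric group of degree 3 and $C_k$ the cyclic group of order $k$. *)

theory Defs
  imports
    Complex_Main
    "HOL-Computational_Algebra.Polynomial"
    "HOL-Algebra.Bij"
    "HOL-Algebra.Elementary_Groups"
    "HOL-Algebra.Sym_Groups"
    "HOL-Algebra.Generated_Fields"
    "HOL-Algebra.Algebraic_Closure_Type"
begin

abbreviation complex_field :: "complex ring" where
  "complex_field \<equiv> ring_of_type_algebra"

text \<open>Splitting fields over the rationals are taken inside the complex numbers, so that it makes
  sense to say that two of them coincide.\<close>

definition splitting_field :: "rat poly \<Rightarrow> complex set" where
  "splitting_field f =
     generate_field complex_field (\<rat> \<union> {z. poly (map_poly of_rat f) z = 0})"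

text \<open>Automorphisms are extensional functions on the splitting field, composed as in
  \<^const>\<open>BijGroup\<close>.\<close>

definition galois_group :: "rat poly \<Rightarrow> (complex \<Rightarrow> complex) monoid" where
  "galois_group f =
     (let K = splitting_field f; R = complex_field\<lparr>carrier := K\<rparr>
      in (BijGroup K)\<lparr>carrier := {\<sigma> \<in> Bij K. \<sigma> \<in> ring_hom R R \<and> (\<forall>q\<in>\<rat>. \<sigma> q = q)}\<rparr>)"

definition f_poly :: "int \<Rightarrow> rat poly" where
  "f_poly a = [:of_int a, of_int a, 0, 1:]"

definition F_form :: "int \<Rightarrow> int \<Rightarrow> int \<Rightarrow> int" where
  "F_form m x y = x^3 - 2*m*x^2*y - 9*m*x*y^2 - m*(2*m + 27)*y^3"

definition admissible :: "int \<Rightarrow> int \<Rightarrow> int \<Rightarrow> bool" where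
  "admissible m x y \<longleftrightarrow>
     gcd x y = 1 \<and> (x, y) \<noteq> (-1, 0) \<and> y \<ge> 0 \<and>
     (F_form m x y)^2 dvd m^3 * (4*m + 27)^5"

text \<open>For nonzero \<open>m\<close>, admissibility forces \<open>F_form m x y \<noteq> 0\<close>, because zero
  divides only zero and \<open>4*m + 27\<close> is odd; so the quotient below is a genuine one.\<close>

definition cond_C :: "int \<Rightarrow> int \<Rightarrow> int \<Rightarrow> int \<Rightarrow> bool" where
  "cond_C m n x y \<longleftrightarrow>
     rat_of_int n = rat_of_int m +
       rat_of_int (m*(4*m + 27)*y*(x^2 + 9*x*y + 27*y^2 + m*y^2)*(x^3 - m*x^2*y - m^2*y^3))
         / rat_of_int ((F_form m x y)^2)"

definition C_solutions :: "int \<Rightarrow> int \<Rightarrow> (int \<times> int) set" where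
  "C_solutions m n = {(x, y). admissible m x y \<and> cond_C m n x y}"

end

theory Submission
  imports Defs "HOL-Computational_Algebra.Primes"
    "HOL-Computational_Algebra.Fundamental_Theorem_Algebra"
begin

text \<open>
  Let \<open>t\<close> be a root of \<open>f\<^sub>m\<close>. The traceless elements of \<open>\<rat>(t)\<close> are the rational multiples of
  \<open>z = x t + y (3 t\<^sup>2 + 2 m)\<close> with \<open>x, y\<close> coprime integers, and
  \<open>z\<^sup>3 + m Q z + m F = 0\<close> with \<open>Q = x\<^sup>2 + 9 x y - 3 m y\<^sup>2\<close> and \<open>F = F\<^sub>m(x, y)\<close>. A multiple \<open>c z\<close>
  is a root of \<open>f\<^sub>n\<close> iff \<open>c = Q / F\<close> and \<open>n F\<^sup>2 = m Q\<^sup>3\<close>, and the latter is condition (C). The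
  divisibility in the notion of admissibility then holds automatically, by an explicit resultant
  computation. So if \<open>f\<^sub>m\<close> is irreducible, the solutions correspond to the roots of \<open>f\<^sub>n\<close> in
  \<open>\<rat>(t)\<close>: there are three if the common splitting field is \<open>\<rat>(t)\<close>, and one if it has degree 6.
  The only reducible case is \<open>m = -8\<close>, with splitting field \<open>\<rat>(\<surd>5)\<close>.
\<close>

section \<open>Condition (C) as an equation between binary forms, and the divisibility by
  elimination\<close>

text \<open>The discriminant of \<open>z^3 + m*Q*z + m*F\<close> is
  \<open>- m^2 * (4*m*Q^3 + 27*F^2)\<close>, and it is a square times the discriminant
  \<open>- m^2 * (4*m + 27)\<close> of \<open>t\<close>. As \<open>4*m\<close> is \<open>-27\<close>
  modulo \<open>4*m + 27\<close>, the latter divides \<open>Q^3 - F^2\<close> as a polynomial; the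
  cofactor is the product that occurs in (C).\<close>

lemma F_sq_Q_cube:
  fixes m x y :: int
  shows "(x^2 + 9*x*y - 3*m*y^2)^3 =
    (F_form m x y)^2 + (4*m + 27)*(y*(x^2 + 9*x*y + 27*y^2 + m*y^2)*(x^3 - m*x^2*y - m^2*y^3))"
  unfolding F_form_def by Groebner_Basis.algebra

lemma cond_C_iff:
  assumes "F_form m x y \<noteq> 0"
  shows "cond_C m n x y \<longleftrightarrow> n * (F_form m x y)^2 = m * (x^2 + 9*x*y - 3*m*y^2)^3"
proof -
  have *: "rat_of_int a = rat_of_int b + rat_of_int c / rat_of_int d \<longleftrightarrow> a * d = b * d + c"
    if "d \<noteq> 0" for a b c d
  proof -
    have "rat_of_int a = rat_of_int b + rat_of_int c / rat_of_int d \<longleftrightarrow>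
        rat_of_int a * rat_of_int d = rat_of_int b * rat_of_int d + rat_of_int c"
      using that by (metis add_divide_eq_iff eq_divide_eq of_int_eq_0_iff)
    also have "\<dots> \<longleftrightarrow> rat_of_int (a * d) = rat_of_int (b * d + c)"
      by (simp only: of_int_mult of_int_add)
    finally show ?thesis by (simp only: of_int_eq_iff)
  qed
  have nz: "(F_form m x y)^2 \<noteq> 0" using assms by simp
  have eq: "m * (F_form m x y)^2
      + m*(4*m + 27)*y*(x^2 + 9*x*y + 27*y^2 + m*y^2)*(x^3 - m*x^2*y - m^2*y^3)
      = m * (x^2 + 9*x*y - 3*m*y^2)^3"
    unfolding F_form_def by Groebner_Basis.algebra
  show ?thesis unfolding cond_C_def *[OF nz] eq by (rule refl)
qed

text \<open>The next two identities are the cofactors, found by inverting the Sylvester matrix,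
  of the binary forms \<open>F\<^sup>2\<close> and \<open>P\<close>, where \<open>Q\<^sup>3 - F\<^sup>2 = (4m + 27) P\<close>.\<close>

lemma sylvester_x:
  fixes m x y :: int
  defines "P \<equiv> y*(x^2 + 9*x*y + 27*y^2 + m*y^2)*(x^3 - m*x^2*y - m^2*y^3)"
  shows "((531441 + 314928*m + 69984*m^2 + 6912*m^3 + 256*m^4)*x^5
      + (1062882*m + 570807*m^2 - 10935*m^3 - 5103*m^4)*x^4*y
      + (1062882*m^2 - 590490*m^3 - 47871*m^4 + 495*m^5)*x^3*y^2
      + (- 531441*m^2 - 2972133*m^3 - 364500*m^4 - 12366*m^5)*x^2*y^3
      + (- 1594323*m^3 - 885735*m^4 - 56862*m^5 + 243*m^6)*x*y^4
      + (- 2657205*m^4 - 295245*m^5 - 7290*m^6)*y^5) * (F_form m x y)^2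
    + ((1062882*m + 688905*m^2 + 290871*m^3 + 32751*m^4 + 1024*m^5)*x^5
      + (1594323*m^2 + 944784*m^3 - 155277*m^4 - 20412*m^5)*x^4*y
      + (- 4782969*m^2 - 2302911*m^3 - 2558790*m^4 - 171801*m^5 + 1980*m^6)*x^3*y^2
      + (- 14348907*m^2 - 24446286*m^3 - 18777582*m^4 - 1930392*m^5 - 49464*m^6)*x^2*y^3
      + (- 43046721*m^3 - 52612659*m^4 - 6908733*m^5 - 227448*m^6 + 972*m^7)*x*y^4
      + (- 71744535*m^4 - 15943230*m^5 - 1180980*m^6 - 29160*m^7)*y^5) * P
    = (4*m + 27)^4 * x^11"
  unfolding F_form_def P_def by Groebner_Basis.algebra

lemma sylvester_y:
  fixes m x y :: int
  defines "P \<equiv> y*(x^2 + 9*x*y + 27*y^2 + m*y^2)*(x^3 - m*x^2*y - m^2*y^3)"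
  shows "(15*x^4*y + (108 - 12*m)*x^3*y^2 + (189 - 80*m - 3*m^2)*x^2*y^3
      + (- 486 - 234*m - 39*m^2)*x*y^4 + (729 + 378*m - 95*m^2 - 7*m^3)*y^5) * (F_form m x y)^2
    + (- 15*x^5 + (27 + 57*m)*x^4*y + (- 27 + 176*m - 48*m^2)*x^3*y^2
      + (405*m - 375*m^2 - 12*m^3)*x^2*y^3 + (- 972*m - 2034*m^2 - 156*m^3)*x*y^4
      + (1458*m - 3591*m^2 - 636*m^3 - 28*m^4)*y^5) * P
    = m^2 * (4*m + 27)^4 * y^11"
  unfolding F_form_def P_def by Groebner_Basis.algebra

text \<open>The equation makes \<open>F^2\<close> divide \<open>m * (4*m + 27) * P\<close>, hence
  \<open>m * (4*m + 27)\<close> times any combination of \<open>F^2\<close> and \<open>P\<close>. By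
  the two elimination identities it divides \<open>m^3 * (4*m + 27)^5\<close> times
  \<open>x^11\<close> and times \<open>y^11\<close>, and a Bezout relation removes these powers. Two
  sextic forms have a Sylvester matrix of size 12, whence the exponent 11.\<close>

lemma F_sq_dvd:
  fixes m n x y :: int
  assumes "coprime x y" and "n * (F_form m x y)^2 = m * (x^2 + 9*x*y - 3*m*y^2)^3"
  shows "(F_form m x y)^2 dvd m^3 * (4*m + 27)^5"
proof -
  let ?P = "y*(x^2 + 9*x*y + 27*y^2 + m*y^2)*(x^3 - m*x^2*y - m^2*y^3)"
  let ?D = "4*m + 27"
  let ?F = "F_form m x y"
  have "m * ?D * ?P = (n - m) * ?F^2"
    using assms(2) unfolding F_sq_Q_cube by (simp add: algebra_simps)
  hence dvd: "?F^2 dvd m * ?D * ?P" by simp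
  have comb: "?F^2 dvd m * ?D * (U * ?F^2 + V * ?P)" for U V
  proof -
    have "m * ?D * (U * ?F^2 + V * ?P) = ?F^2 * (m * ?D * U) + V * (m * ?D * ?P)"
      by (simp only: algebra_simps)
    thus ?thesis using dvd by simp
  qed
  have "?F^2 dvd m * ?D * (?D^4 * x^11)"
    unfolding sylvester_x[where m = m and x = x and y = y, symmetric] by (rule comb)
  moreover have "m^3 * ?D^5 * x^11 = m^2 * (m * ?D * (?D^4 * x^11))"
    by Groebner_Basis.algebra
  ultimately have dx: "?F^2 dvd m^3 * ?D^5 * x^11" by (metis dvd_mult)
  have "?F^2 dvd m * ?D * (m^2 * ?D^4 * y^11)"
    unfolding sylvester_y[where m = m and x = x and y = y, symmetric] by (rule comb)
  moreover have "m^3 * ?D^5 * y^11 = m * ?D * (m^2 * ?D^4 * y^11)"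
    by Groebner_Basis.algebra
  ultimately have dy: "?F^2 dvd m^3 * ?D^5 * y^11" by (simp only:)
  have "coprime (x^11) (y^11)" using assms(1) by simp
  then obtain a b where "a * x^11 + b * y^11 = 1" using bezout_int[of "x^11" "y^11"] by auto
  hence "m^3 * ?D^5 = m^3 * ?D^5 * (a * x^11 + b * y^11)" by simp
  also have "\<dots> = a * (m^3 * ?D^5 * x^11) + b * (m^3 * ?D^5 * y^11)"
    by (simp only: algebra_simps)
  finally have "m^3 * ?D^5 = a * (m^3 * ?D^5 * x^11) + b * (m^3 * ?D^5 * y^11)" .
  thus ?thesis using dvd_add[OF dvd_mult[OF dx, of a] dvd_mult[OF dy, of b]] by argo
qed

lemma odd_disc_nonzero: "4*m + 27 \<noteq> (0::int)" by presburger

text \<open>The divisibility is traded for \<open>F \<noteq> 0\<close>: zero does not divide the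
  nonzero number \<open>m^3 * (4*m + 27)^5\<close>, and conversely \<open>F_sq_dvd\<close> recovers
  the divisibility from the equation.\<close>

lemma C_solutions_iff:
  assumes "m \<noteq> 0"
  shows "(x, y) \<in> C_solutions m n \<longleftrightarrow>
    coprime x y \<and> (x, y) \<noteq> (-1, 0) \<and> y \<ge> 0 \<and> F_form m x y \<noteq> 0 \<and>
    n * (F_form m x y)^2 = m * (x^2 + 9*x*y - 3*m*y^2)^3"
proof
  assume "(x, y) \<in> C_solutions m n"
  hence *: "admissible m x y" "cond_C m n x y" by (auto simp: C_solutions_def)
  hence "F_form m x y \<noteq> 0"
    using assms odd_disc_nonzero[of m] by (auto simp: admissible_def)
  with * show "coprime x y \<and> (x, y) \<noteq> (-1, 0) \<and> y \<ge> 0 \<and> F_form m x y \<noteq> 0 \<and>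
    n * (F_form m x y)^2 = m * (x^2 + 9*x*y - 3*m*y^2)^3"
    using cond_C_iff by (auto simp: admissible_def coprime_iff_gcd_eq_1)
next
  assume "coprime x y \<and> (x, y) \<noteq> (-1, 0) \<and> y \<ge> 0 \<and> F_form m x y \<noteq> 0 \<and>
    n * (F_form m x y)^2 = m * (x^2 + 9*x*y - 3*m*y^2)^3"
  thus "(x, y) \<in> C_solutions m n"
    using cond_C_iff[of m x y n] F_sq_dvd[of x y n m] unfolding C_solutions_def admissible_def
    by (simp add: coprime_iff_gcd_eq_1)
qed

section \<open>The solutions for \<open>m = n = -8\<close>\<close>

text \<open>The exponent of 5 is even on the left and odd on the right.\<close>

lemma five_times_square:
  fixes a b :: int
  assumes "a^2 = 5 * b^2"
  shows "a = 0 \<and> b = 0"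
proof (rule ccontr)
  assume "\<not> ?thesis"
  hence nz: "a \<noteq> 0" "b \<noteq> 0" using assms by auto
  have p: "prime (5::int)" by simp
  have "multiplicity 5 (a^2) = 2 * multiplicity 5 a"
    using p nz by (simp add: prime_elem_multiplicity_power_distrib)
  moreover have "multiplicity 5 (5 * b^2) = 1 + 2 * multiplicity 5 b"
    using p nz by (simp add: prime_elem_multiplicity_mult_distrib prime_elem_multiplicity_power_distrib)
  ultimately have "2 * multiplicity 5 a = 1 + 2 * multiplicity 5 b" using assms by simp
  thus False by presburger
qed

lemma reducible_solutions: "C_solutions (-8) (-8) = {(1, 0), (-4, 1)}"
proof -
  have "(x, y) = (1, 0) \<or> (x, y) = (-4, 1)" if "(x, y) \<in> C_solutions (-8) (-8)" for x y :: int
  proof -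
    have cop: "coprime x y" and ne: "(x, y) \<noteq> (-1, 0)" and y: "y \<ge> 0"
      and eq: "(F_form (-8) x y)^2 = (x^2 + 9*x*y + 24*y^2)^3"
      using that by (auto simp: C_solutions_iff)
    \<comment> \<open>For \<open>m = n\<close> condition (C) says that \<open>P = 0\<close>. At
      \<open>m = -8\<close> the form \<open>P\<close> splits into \<open>y\<close>,
      \<open>x + 4*y\<close> and two quadratic forms; completing squares shows that the latter have
      no nontrivial zero, as 5 is not a square.\<close>
    have "y * (x + 4*y) * ((2*x + 9*y)^2 - 5*y^2) * ((x + 2*y)^2 - 5*(2*y)^2) = 0"
      using eq unfolding F_form_def by Groebner_Basis.algebra
    then consider "y = 0" | "x + 4*y = 0" | "(2*x + 9*y)^2 = 5*y^2" | "(x + 2*y)^2 = 5*(2*y)^2"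
      by force
    then consider "y = 0" | "x + 4*y = 0"
      using five_times_square[of "2*x + 9*y" y] five_times_square[of "x + 2*y" "2*y"]
      by cases auto
    thus ?thesis
    proof cases
      case 2
      hence x: "x = - 4 * y" by simp
      hence "is_unit y" using cop by (metis coprime_common_divisor dvd_mult dvd_refl)
      thus ?thesis using x y by (simp add: abs_if)
    qed (use cop ne in \<open>auto simp: abs_if split: if_splits\<close>)
  qed
  moreover have "(1, 0) \<in> C_solutions (-8) (-8)" "(-4, 1) \<in> C_solutions (-8) (-8)"
    by (simp_all add: C_solutions_iff F_form_def)
  ultimately show ?thesis by auto
qed

section \<open>Roots of the cubic and subfields of the complex numbers\<close>

definition cubic_root :: "int \<Rightarrow> complex \<Rightarrow> bool" where
  "cubic_root m t \<longleftrightarrow> t^3 + of_int m * t + of_int m = 0"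

definition no_rational_root :: "int \<Rightarrow> bool" where
  "no_rational_root m \<longleftrightarrow> (\<forall>q\<in>\<rat>. \<not> cubic_root m q)"

text \<open>Vieta's relations for the three roots. As polynomial equations they reduce identities
  between the roots to ideal membership.\<close>

definition root_triple :: "int \<Rightarrow> complex \<Rightarrow> complex \<Rightarrow> complex \<Rightarrow> bool" where
  "root_triple m t u v \<longleftrightarrow>
     t + u + v = 0 \<and> t*u + t*v + u*v = of_int m \<and> t*u*v = - of_int m"

definition complex_subfield :: "complex set \<Rightarrow> bool" where
  "complex_subfield S \<longleftrightarrow> \<rat> \<subseteq> S \<and> (\<forall>x\<in>S. \<forall>y\<in>S. x + y \<in> S \<and> x * y \<in> S) \<and>
     (\<forall>x\<in>S. x \<noteq> 0 \<longrightarrow> inverse x \<in> S)"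

text \<open>This is the field \<rat>(t) when \<open>t\<close> is a root of an irreducible
  cubic.\<close>

definition quadratic_span :: "complex \<Rightarrow> complex set" where
  "quadratic_span t = {a + b*t + c*t^2 |a b c. a \<in> \<rat> \<and> b \<in> \<rat> \<and> c \<in> \<rat>}"

lemma complex_subfieldD:
  assumes "complex_subfield S"
  shows "q \<in> \<rat> \<Longrightarrow> q \<in> S"
    and "x \<in> S \<Longrightarrow> y \<in> S \<Longrightarrow> x + y \<in> S"
    and "x \<in> S \<Longrightarrow> y \<in> S \<Longrightarrow> x * y \<in> S"
    and "x \<in> S \<Longrightarrow> - x \<in> S"
    and "x \<in> S \<Longrightarrow> y \<in> S \<Longrightarrow> x - y \<in> S"
    and "x \<in> S \<Longrightarrow> inverse x \<in> S"
    and "x \<in> S \<Longrightarrow> y \<in> S \<Longrightarrow> x / y \<in> S"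
    and "x \<in> S \<Longrightarrow> x ^ k \<in> S"
proof -
  show rat: "q \<in> S" if "q \<in> \<rat>" for q using assms that by (auto simp: complex_subfield_def)
  show add: "x + y \<in> S" if "x \<in> S" "y \<in> S" for x y using assms that by (auto simp: complex_subfield_def)
  show mult: "x * y \<in> S" if "x \<in> S" "y \<in> S" for x y using assms that by (auto simp: complex_subfield_def)
  show neg: "- x \<in> S" if "x \<in> S" for x using mult[OF rat[of "-1"] that] by simp
  show "x - y \<in> S" if "x \<in> S" "y \<in> S" for x y using add[OF that(1) neg[OF that(2)]] by simp
  show inv: "inverse x \<in> S" if "x \<in> S" for x
    using assms that rat by (cases "x = 0") (auto simp: complex_subfield_def)
  show "x / y \<in> S" if "x \<in> S" "y \<in> S" for x y
    using mult[OF that(1) inv[OF that(2)]] by (simp add: divide_inverse)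
  show "x ^ k \<in> S" if "x \<in> S" for x using that by (induction k) (auto intro: mult rat)
qed

lemma complex_field_simps [simp]:
  "x \<oplus>\<^bsub>complex_field\<^esub> y = x + y" "x \<otimes>\<^bsub>complex_field\<^esub> y = x * y"
  "\<one>\<^bsub>complex_field\<^esub> = 1" "\<zero>\<^bsub>complex_field\<^esub> = 0" "carrier complex_field = UNIV"
  by (simp_all add: ring_of_type_algebra_def)

lemma complex_field_a_inv: "\<ominus>\<^bsub>complex_field\<^esub> x = - x"
proof -
  interpret field complex_field by (rule field_from_type_algebra)
  show ?thesis by (rule sum_zero_eq_neg[symmetric]) auto
qed

lemma complex_field_m_inv: "x \<noteq> 0 \<Longrightarrow> inv\<^bsub>complex_field\<^esub> x = inverse x"
proof -
  interpret field complex_field by (rule field_from_type_algebra)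
  assume "x \<noteq> 0"
  thus ?thesis by (intro comm_inv_char) auto
qed

lemma poly_f_poly: "poly (map_poly of_rat (f_poly m)) z = 0 \<longleftrightarrow> cubic_root m z"
proof -
  have "map_poly of_rat (f_poly m) = ([:of_int m, of_int m, 0, 1:] :: complex poly)"
    by (simp add: f_poly_def map_poly_pCons)
  thus ?thesis by (simp add: cubic_root_def algebra_simps power3_eq_cube)
qed

lemma complex_subfield_splitting_field: "complex_subfield (splitting_field f)"
  unfolding complex_subfield_def splitting_field_def
proof (intro conjI ballI impI subsetI, goal_cases)
  case (1 x)
  thus ?case by (intro generate_field.incl) simp
next
  case (2 x y)
  thus ?case using generate_field.eng_add[of x complex_field _ y] by simp
next
  case (3 x y)
  thus ?case using generate_field.eng_mult[of x complex_field _ y] by simp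
next
  case (4 x)
  thus ?case using generate_field.m_inv[of x complex_field] by (simp add: complex_field_m_inv)
qed

lemma root_in_splitting_field: "cubic_root m z \<Longrightarrow> z \<in> splitting_field (f_poly m)"
  unfolding splitting_field_def by (intro generate_field.incl) (simp add: poly_f_poly)

lemma splitting_field_subset:
  assumes "complex_subfield S" and "\<And>z. cubic_root m z \<Longrightarrow> z \<in> S"
  shows "splitting_field (f_poly m) \<subseteq> S"
proof
  fix z assume "z \<in> splitting_field (f_poly m)"
  thus "z \<in> S" unfolding splitting_field_def
    by (induction rule: generate_field.induct)
       (use assms in \<open>auto simp: poly_f_poly complex_field_a_inv complex_field_m_inv
          intro: complex_subfieldD\<close>)
qed

lemma root_triple_exists: obtains t u v where "root_triple m t u v"
proof -
  let ?p = "[:of_int m, of_int m, 0, 1:] :: complex poly"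
  have "\<not> constant (poly ?p)" by (simp add: constant_degree)
  then obtain t where "poly ?p t = 0" using fundamental_theorem_of_algebra by blast
  hence t: "t^3 + of_int m * t + of_int m = 0" by (simp add: algebra_simps power3_eq_cube)
  \<comment> \<open>Dividing the cubic by \<open>X - t\<close> leaves
    \<open>X^2 + t*X + t^2 + m\<close>, whose discriminant is \<open>-3*t^2 - 4*m\<close>.\<close>
  define s where "s = csqrt (-3*t^2 - 4 * of_int m)"
  have s: "s^2 = -3*t^2 - 4 * of_int m" by (simp add: s_def)
  have "root_triple m t ((-t + s)/2) ((-t - s)/2)"
    using t s unfolding root_triple_def
    by (simp add: field_simps) Groebner_Basis.algebra
  thus ?thesis by (rule that)
qed

lemma root_triple_swap:
  assumes "root_triple m t u v"
  shows "root_triple m u t v" "root_triple m t v u" "root_triple m v u t"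
    "root_triple m u v t" "root_triple m v t u"
  using assms unfolding root_triple_def by (auto simp: algebra_simps)

lemma root_triple_iff:
  assumes "root_triple m t u v"
  shows "cubic_root m z \<longleftrightarrow> z = t \<or> z = u \<or> z = v"
proof -
  have "z^3 + of_int m * z + of_int m = (z - t) * (z - u) * (z - v)"
    using assms unfolding root_triple_def by Groebner_Basis.algebra
  thus ?thesis by (simp add: cubic_root_def)
qed

lemma root_triple_disc:
  assumes "root_triple m t u v"
  shows "((t - u) * (u - v) * (v - t))^2 = - (of_int m^2 * (4 * of_int m + 27))"
  using assms unfolding root_triple_def by Groebner_Basis.algebra

lemma root_triple_distinct:
  assumes "root_triple m t u v" and "m \<noteq> 0"
  shows "t \<noteq> u" "u \<noteq> v" "t \<noteq> v"
proof -
  have "of_int m^2 * (4 * of_int m + 27) = complex_of_int (m^2 * (4*m + 27))" by simp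
  also have "\<dots> \<noteq> 0" using assms(2) odd_disc_nonzero[of m] by (simp only: of_int_eq_0_iff) simp
  finally have "((t - u) * (u - v) * (v - t))^2 \<noteq> 0"
    using root_triple_disc[OF assms(1)] by simp
  thus "t \<noteq> u" "u \<noteq> v" "t \<noteq> v" by auto
qed

text \<open>Otherwise \<open>t\<close> satisfies \<open>t\<^sup>2 + b t + a = 0\<close>, and dividing the cubic by this quadratic
  leaves a linear factor with the rational root \<open>b\<close>.\<close>

lemma rational_independent:
  assumes "no_rational_root m" "cubic_root m t" "a \<in> \<rat>" "b \<in> \<rat>" "c \<in> \<rat>" "a + b*t + c*t^2 = 0"
  shows "a = 0 \<and> b = 0 \<and> c = 0"
proof -
  have t_nrat: "t \<notin> \<rat>" using assms by (auto simp: no_rational_root_def)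
  have lin: "p = 0 \<and> q = 0" if "p \<in> \<rat>" "q \<in> \<rat>" "p + q * t = 0" for p q
  proof -
    have "q = 0"
    proof (rule ccontr)
      assume "q \<noteq> 0"
      hence "t = - p / q" using that(3) by (simp add: field_simps add_eq_0_iff)
      thus False using t_nrat that by simp
    qed
    thus ?thesis using that by simp
  qed
  have "c = 0"
  proof (rule ccontr)
    assume "c \<noteq> 0"
    define p q where "p = a / c" and "q = b / c"
    have rat: "p \<in> \<rat>" "q \<in> \<rat>" using assms by (auto simp: p_def q_def)
    have "t^2 + q*t + p = (a + b*t + c*t^2) / c"
      using \<open>c \<noteq> 0\<close> by (simp add: p_def q_def add_divide_distrib)
    hence quad: "t^2 + q*t + p = 0" using assms(6) by simp
    have "(p*q + of_int m) + (q^2 - p + of_int m) * t = 0"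
      using quad assms(2) unfolding cubic_root_def by Groebner_Basis.algebra
    hence "p*q + of_int m = 0" "q^2 - p + of_int m = 0"
      using lin[of "p*q + of_int m" "q^2 - p + of_int m"] rat by auto
    hence "cubic_root m q" unfolding cubic_root_def by Groebner_Basis.algebra
    thus False using assms(1) rat by (auto simp: no_rational_root_def)
  qed
  thus ?thesis using lin[of a b] assms by auto
qed

section \<open>The cubic field \<rat>(t)\<close>

lemma quadratic_spanI: "a \<in> \<rat> \<Longrightarrow> b \<in> \<rat> \<Longrightarrow> c \<in> \<rat> \<Longrightarrow> a + b*t + c*t^2 \<in> quadratic_span t"
  unfolding quadratic_span_def by blast

lemma quadratic_spanE:
  assumes "z \<in> quadratic_span t"
  obtains a b c where "a \<in> \<rat>" "b \<in> \<rat>" "c \<in> \<rat>" "z = a + b*t + c*t^2"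
  using assms unfolding quadratic_span_def by blast

lemma generator_in_quadratic_span: "t \<in> quadratic_span t"
  using quadratic_spanI[of 0 1 0 t] by simp

lemma quadratic_span_mult:
  assumes "cubic_root m t"
  shows "(a + b*t + c*t^2) * (a' + b'*t + c'*t^2) =
    (a*a' - of_int m * (b*c' + c*b')) + (a*b' + b*a' - of_int m * (b*c' + c*b') - of_int m * (c*c')) * t
    + (a*c' + b*b' + c*a' - of_int m * (c*c')) * t^2"
  using assms unfolding cubic_root_def by Groebner_Basis.algebra

text \<open>Products reduce by the cubic equation. The inverse of an element is the product of its
  two other conjugates divided by its norm; the conjugates are nonzero because
  \<open>1, u, u^2\<close> and \<open>1, v, v^2\<close> are independent as well.\<close>

lemma complex_subfield_quadratic_span:
  assumes irr: "no_rational_root m" and t: "cubic_root m t"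
  shows "complex_subfield (quadratic_span t)"
  unfolding complex_subfield_def
proof (intro conjI ballI impI subsetI)
  fix q :: complex assume "q \<in> \<rat>"
  thus "q \<in> quadratic_span t" using quadratic_spanI[of q 0 0 t] by simp
next
  fix x y assume x: "x \<in> quadratic_span t" and y: "y \<in> quadratic_span t"
  obtain a b c where abc: "a \<in> \<rat>" "b \<in> \<rat>" "c \<in> \<rat>" "x = a + b*t + c*t^2" using x by (rule quadratic_spanE)
  obtain a' b' c' where abc': "a' \<in> \<rat>" "b' \<in> \<rat>" "c' \<in> \<rat>" "y = a' + b'*t + c'*t^2"
    using y by (rule quadratic_spanE)
  have "x + y = (a + a') + (b + b')*t + (c + c')*t^2" using abc abc' by (simp add: algebra_simps)
  thus "x + y \<in> quadratic_span t" using abc abc' by (simp only:) (intro quadratic_spanI Rats_add)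
  show "x * y \<in> quadratic_span t"
    unfolding abc(4) abc'(4) quadratic_span_mult[OF t] using abc(1-3) abc'(1-3)
    by (intro quadratic_spanI) simp_all
next
  fix x assume x: "x \<in> quadratic_span t" and "x \<noteq> 0"
  obtain a b c where abc: "a \<in> \<rat>" "b \<in> \<rat>" "c \<in> \<rat>" "x = a + b*t + c*t^2" using x by (rule quadratic_spanE)
  obtain t0 u0 v0 where triple0: "root_triple m t0 u0 v0" by (rule root_triple_exists)
  then obtain u v where tr: "root_triple m t u v"
    using root_triple_iff[OF triple0, of t] t root_triple_swap[OF triple0] by blast
  have u: "cubic_root m u" and v: "cubic_root m v" using root_triple_iff[OF tr] by auto
  \<comment> \<open>Coordinates of the product of the conjugates of \<open>x\<close> at
    \<open>u\<close> and \<open>v\<close>, which is symmetric in \<open>u\<close> and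
    \<open>v\<close> and so a polynomial in \<open>t\<close>. \<open>N\<close> is the norm, read off
    as the constant coefficient of the product with \<open>x\<close>.\<close>
  define A B C where "A = a^2 - 2*of_int m*a*c + of_int m*b^2 + of_int m*b*c + of_int m^2*c^2"
    and "B = - a*b - of_int m*c^2" and "C = - a*c + b^2 + of_int m*c^2"
  define N where "N = a*A - of_int m*(b*C + c*B)"
  have conj: "(a + b*u + c*u^2) * (a + b*v + c*v^2) = A + B*t + C*t^2"
    using tr unfolding root_triple_def A_def B_def C_def by Groebner_Basis.algebra
  have N: "x * (A + B*t + C*t^2) = N"
    using t unfolding cubic_root_def N_def A_def B_def C_def abc(4) by Groebner_Basis.algebra
  have "A + B*t + C*t^2 \<noteq> 0"
  proof
    assume "A + B*t + C*t^2 = 0"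
    hence "a + b*u + c*u^2 = 0 \<or> a + b*v + c*v^2 = 0" using conj by simp
    hence "a = 0 \<and> b = 0 \<and> c = 0"
      using rational_independent[OF irr u abc(1-3)] rational_independent[OF irr v abc(1-3)] by blast
    thus False using \<open>x \<noteq> 0\<close> abc by simp
  qed
  hence "N \<noteq> 0" using N \<open>x \<noteq> 0\<close> by auto
  have rat: "A \<in> \<rat>" "B \<in> \<rat>" "C \<in> \<rat>" using abc by (simp_all add: A_def B_def C_def)
  hence "N \<in> \<rat>" using abc by (simp add: N_def)
  have "inverse x = (A + B*t + C*t^2) / N"
    using N \<open>N \<noteq> 0\<close> \<open>x \<noteq> 0\<close> by (simp add: field_simps)
  also have "\<dots> = A/N + (B/N)*t + (C/N)*t^2" by (simp add: add_divide_distrib)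
  also have "\<dots> \<in> quadratic_span t" using rat \<open>N \<in> \<rat>\<close> by (intro quadratic_spanI) simp_all
  finally show "inverse x \<in> quadratic_span t" .
qed

lemma quadratic_span_subset:
  assumes "complex_subfield S" "t \<in> S" shows "quadratic_span t \<subseteq> S"
  using complex_subfieldD[OF assms(1)] assms(2) by (auto elim!: quadratic_spanE)

section \<open>Traceless elements, and the discriminant criterion for a cyclic cubic\<close>

text \<open>The form is the index form of \<open>z = x*t + y*(3*t^2 + 2*m)\<close>: the determinant
  of the coefficients of \<open>t\<close> and \<open>t^2\<close> in \<open>z\<close> and
  \<open>z^2\<close>. Putting \<open>x = 3*y*q\<close> turns it into \<open>27*y^3\<close> times the
  cubic at \<open>q\<close>, so a nontrivial zero yields a rational root.\<close>

lemma trace_form_nonzero: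
  fixes x y :: complex
  assumes "no_rational_root m" "x \<in> \<rat>" "y \<in> \<rat>" "x^3 + 9 * of_int m*x*y^2 + 27 * of_int m*y^3 = 0"
  shows "x = 0 \<and> y = 0"
proof -
  have "y = 0"
  proof (rule ccontr)
    assume y: "y \<noteq> 0"
    define q where "q = x / (3*y)"
    have x: "x = 3*y*q" using y by (simp add: q_def)
    have "27 * y^3 * (q^3 + of_int m*q + of_int m) = 0"
      using assms(4) unfolding x by Groebner_Basis.algebra
    hence "cubic_root m q" using y by (simp add: cubic_root_def)
    thus False using assms by (auto simp: no_rational_root_def q_def)
  qed
  thus ?thesis using assms by simp
qed

text \<open>In the basis \<open>1\<close>, \<open>t\<close>, \<open>3t\<^sup>2 + 2m\<close> the last two elements have trace zero.\<close>

lemma quadratic_span_traceE: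
  assumes "z \<in> quadratic_span t"
  obtains e x y where "e \<in> \<rat>" "x \<in> \<rat>" "y \<in> \<rat>" "z = e + (x*t + y*(3*t^2 + 2 * of_int m))"
proof -
  obtain a b c where abc: "a \<in> \<rat>" "b \<in> \<rat>" "c \<in> \<rat>" "z = a + b*t + c*t^2"
    using assms by (rule quadratic_spanE)
  show ?thesis
    by (rule that[of "a - 2 * of_int m * (c/3)" b "c/3"]) (use abc in \<open>simp_all add: algebra_simps\<close>)
qed

lemma trace_basis_independent:
  assumes "no_rational_root m" "cubic_root m t" "e \<in> \<rat>" "x \<in> \<rat>" "y \<in> \<rat>"
    and "e + (x*t + y*(3*t^2 + 2 * of_int m)) = 0"
  shows "e = 0 \<and> x = 0 \<and> y = 0"
proof -
  have "(e + 2 * of_int m * y) + x*t + (3*y)*t^2 = 0" using assms(6) by (simp add: algebra_simps)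
  hence "e + 2 * of_int m * y = 0 \<and> x = 0 \<and> 3*y = 0"
    using assms(3-5) by (intro rational_independent[OF assms(1,2)]) simp_all
  thus ?thesis by auto
qed

text \<open>A cubic field contains no quadratic one. Concretely, the coefficients of
  \<open>t\<close> and \<open>t^2\<close> in \<open>z^2\<close> vanish, and this forces the
  traceless part of \<open>z\<close> to be zero.\<close>

lemma rational_square_root:
  assumes irr: "no_rational_root m" and t: "cubic_root m t"
    and z: "z \<in> quadratic_span t" "z^2 \<in> \<rat>"
  shows "z \<in> \<rat>"
proof -
  obtain e x y where exy: "e \<in> \<rat>" "x \<in> \<rat>" "y \<in> \<rat>" "z = e + (x*t + y*(3*t^2 + 2 * of_int m))"
    using z(1) by (rule quadratic_span_traceE[where m = m])
  define k where "k = e^2 + 4*e*y*of_int m - 6*x*y*of_int m + 4*of_int m^2*y^2 - z^2"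
  have "k + (2*e*x - 2*of_int m*x*y - 9*of_int m*y^2)*t + (6*e*y + x^2 + 3*of_int m*y^2)*t^2 = 0"
    using t unfolding k_def exy(4) cubic_root_def by Groebner_Basis.algebra
  moreover have "k \<in> \<rat>" using exy(1-3) z(2) by (simp add: k_def)
  ultimately have eqs: "2*e*x - 2*of_int m*x*y - 9*of_int m*y^2 = 0" "6*e*y + x^2 + 3*of_int m*y^2 = 0"
    using rational_independent[OF irr t, of k "2*e*x - 2*of_int m*x*y - 9*of_int m*y^2"
      "6*e*y + x^2 + 3*of_int m*y^2"] exy(1-3) by auto
  \<comment> \<open>Eliminating \<open>e\<close> between the two equations leaves the index
    form.\<close>
  have "x^3 + 9 * of_int m*x*y^2 + 27 * of_int m*y^3 = 0" using eqs by Groebner_Basis.algebra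
  hence "x = 0 \<and> y = 0" by (rule trace_form_nonzero[OF irr exy(2,3)])
  thus ?thesis using exy by simp
qed

text \<open>Clear denominators and divide by the gcd. Of the two opposite primitive pairs the one
  normalised as in \<open>admissible\<close> is kept: second entry positive, or the pair
  \<open>(1, 0)\<close>.\<close>

lemma primitive_integer_pair:
  fixes x y :: complex
  assumes "x \<in> \<rat>" "y \<in> \<rat>" "x \<noteq> 0 \<or> y \<noteq> 0"
  obtains c :: complex and I J :: int where "c \<in> \<rat>" "x = c * of_int I" "y = c * of_int J"
    "coprime I J" "J \<ge> 0" "(I, J) \<noteq> (-1, 0)"
proof -
  obtain a b where ab: "b > 0" "x = of_int a / of_int b"
    using assms(1) by (elim Rats_cases') auto
  obtain a' b' where ab': "b' > 0" "y = of_int a' / of_int b'"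
    using assms(2) by (elim Rats_cases') auto
  define p q g where "p = a * b'" and "q = a' * b" and "g = gcd p q"
  have "p \<noteq> 0 \<or> q \<noteq> 0" using assms(3) ab ab' by (auto simp: p_def q_def)
  hence g: "g \<noteq> 0" by (simp add: g_def)
  \<comment> \<open>The sign that performs this normalisation.\<close>
  define s :: int where "s = (if q < 0 \<or> q = 0 \<and> p < 0 then -1 else 1)"
  have s: "s * s = 1" by (simp add: s_def)
  define I J where "I = s * (p div g)" and "J = s * (q div g)"
  have p: "p = s * g * I" and q: "q = s * g * J"
    using s by (auto simp: I_def J_def g_def s_def)
  have "coprime (p div g) (q div g)"
    using g unfolding g_def by (intro div_gcd_coprime) auto
  hence cop: "coprime I J" by (auto simp: I_def J_def s_def)
  have gpos: "g > 0" using g by (simp add: g_def less_le)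
  have Jnn: "J \<ge> 0"
  proof (cases "q < 0")
    case True
    hence "s = -1" by (simp add: s_def)
    hence "g * J = - q" using q by simp
    thus ?thesis using True gpos by (metis neg_0_less_iff_less order_less_imp_le zero_less_mult_pos)
  next
    case False
    thus ?thesis using gpos by (auto simp: J_def s_def pos_imp_zdiv_nonneg_iff)
  qed
  have ne: "(I, J) \<noteq> (-1, 0)"
  proof
    assume "(I, J) = (-1, 0)"
    hence "p = - s * g" "q = 0" using p q by auto
    thus False using gpos by (auto simp: s_def split: if_splits)
  qed
  define c where "c = (of_int (s * g) / of_int (b * b') :: complex)"
  have "x = of_int p / of_int (b * b')" "y = of_int q / of_int (b * b')"
    using ab ab' by (simp_all add: p_def q_def)
  hence "x = c * of_int I" "y = c * of_int J"
    unfolding c_def p q by simp_all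
  moreover have "c \<in> \<rat>" by (simp add: c_def)
  ultimately show ?thesis using that cop Jnn ne by blast
qed

lemma integer_of_rational_square:
  fixes q :: complex
  assumes "q \<in> \<rat>" "q^2 = of_int k"
  shows "\<exists>j. k = j^2"
proof -
  \<comment> \<open>The primitive pair proportional to \<open>(q, 1)\<close> writes \<open>q\<close>
    as \<open>I / J\<close> in lowest terms.\<close>
  obtain c :: complex and I J :: int where *: "c \<in> \<rat>" "q = c * of_int I" "1 = c * of_int J" "coprime I J"
    using primitive_integer_pair[of q 1, OF assms(1)] by (metis Rats_1 zero_neq_one)
  have "complex_of_int (I^2) = of_int (k * J^2)"
    using *(2,3) assms(2) by simp Groebner_Basis.algebra
  hence eq: "I^2 = k * J^2" by (simp only: of_int_eq_iff)
  hence "J^2 dvd I^2" by simp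
  moreover have "coprime (I^2) (J^2)" using *(4) by simp
  ultimately have "is_unit (J^2)" by (metis coprime_common_divisor dvd_refl)
  hence "J^2 = 1" by (simp add: is_unit_power_iff abs_if split: if_splits)
  thus ?thesis using eq by auto
qed

text \<open>With \<open>u\<close> also \<open>v = - t - u\<close> lies in \<rat>(t), hence so does
  the square root \<open>d\<close> of the discriminant \<open>- m^2 * (4*m + 27)\<close>. A cubic
  field leaves no room for it unless \<open>d\<close> is rational, and then \<open>d / m\<close> is
  a rational square root of an integer.\<close>

lemma square_disc_if_in_span:
  assumes "m \<noteq> 0" "no_rational_root m" "root_triple m t u v" "u \<in> quadratic_span t"
  shows "\<exists>k. - (4*m + 27) = k^2"
proof -
  have t: "cubic_root m t" using root_triple_iff[OF assms(3)] by simp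
  note nf = complex_subfieldD[OF complex_subfield_quadratic_span[OF assms(2) t]]
  have v: "v = - t - u" using assms(3) unfolding root_triple_def by Groebner_Basis.algebra
  define d where "d = (t - u) * (u - v) * (v - t)"
  have "d \<in> quadratic_span t"
    unfolding d_def v using assms(4) generator_in_quadratic_span by (intro nf(2-8))
  moreover have d2: "d^2 = - (of_int m^2 * (4 * of_int m + 27))"
    unfolding d_def by (rule root_triple_disc[OF assms(3)])
  hence "d^2 \<in> \<rat>" by simp
  ultimately have "d \<in> \<rat>" by (rule rational_square_root[OF assms(2) t])
  hence "d / of_int m \<in> \<rat>" by simp
  moreover have "(d / of_int m)^2 = of_int (- (4*m + 27))"
    using assms(1) by (simp add: power_divide d2)
  ultimately show ?thesis by (rule integer_of_rational_square)
qed

text \<open>Now \<open>d\<close> is rational, and \<open>u - v\<close> is \<open>d\<close> divided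
  by \<open>(t - u) * (v - t)\<close>, which is minus the derivative \<open>3*t^2 + m\<close> of the
  cubic at \<open>t\<close>. Together with \<open>u + v = - t\<close> this expresses
  \<open>u\<close> through \<open>t\<close>.\<close>

lemma in_span_if_square_disc:
  assumes "m \<noteq> 0" "no_rational_root m" "root_triple m t u v" "- (4*m + 27) = k^2"
  shows "u \<in> quadratic_span t"
proof -
  have t: "cubic_root m t" using root_triple_iff[OF assms(3)] by simp
  note nf = complex_subfieldD[OF complex_subfield_quadratic_span[OF assms(2) t]]
  define d where "d = (t - u) * (u - v) * (v - t)"
  have "- (4 * of_int m + 27) = (complex_of_int k)^2"
    using arg_cong[OF assms(4), of complex_of_int] by simp
  hence "d^2 = (of_int (m * k))^2"
    using root_triple_disc[OF assms(3)] unfolding d_def by simp Groebner_Basis.algebra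
  hence "d = of_int (m * k) \<or> d = - of_int (m * k)" by (simp only: power2_eq_iff)
  hence "d \<in> \<rat>" by (metis Rats_minus_iff Rats_of_int)
  have "(t - u) * (v - t) = - of_int m + 0 * t + (-3) * t^2"
    using assms(3) unfolding root_triple_def by Groebner_Basis.algebra
  hence w: "(t - u) * (v - t) \<in> quadratic_span t"
    by (simp only:) (intro quadratic_spanI; simp)
  have "(t - u) * (v - t) \<noteq> 0" using root_triple_distinct[OF assms(3,1)] by simp
  hence "u - v = d / ((t - u) * (v - t))" by (simp add: d_def)
  moreover have "u * 2 = (u - v) - t"
    using assms(3) unfolding root_triple_def by Groebner_Basis.algebra
  ultimately have "u = (d / ((t - u) * (v - t)) - t) / 2" by simp
  also have "\<dots> \<in> quadratic_span t"
    using nf(1)[OF \<open>d \<in> \<rat>\<close>] w generator_in_quadratic_span nf(1)[of 2]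
    by (intro nf(7)[OF nf(5)[OF nf(7)]]) simp_all
  finally show ?thesis .
qed

section \<open>Solutions of (C) correspond to the roots of the second cubic in \<rat>(t)\<close>

definition Q_form :: "int \<Rightarrow> int \<Rightarrow> int \<Rightarrow> int" where
  "Q_form m x y = x^2 + 9*x*y - 3*m*y^2"

definition solution_root :: "int \<Rightarrow> complex \<Rightarrow> int \<times> int \<Rightarrow> complex" where
  "solution_root m t = (\<lambda>(x, y). of_int (Q_form m x y) / of_int (F_form m x y) *
     (of_int x * t + of_int y * (3*t^2 + 2 * of_int m)))"

lemma traceless_cubic:
  fixes x y t :: complex
  assumes "cubic_root m t"
  defines "z \<equiv> x*t + y*(3*t^2 + 2 * of_int m)"
  shows "z^3 + of_int m * (x^2 + 9*x*y - 3*of_int m*y^2) * z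
    + of_int m * (x^3 - 2*of_int m*x^2*y - 9*of_int m*x*y^2 - of_int m*(2*of_int m + 27)*y^3) = 0"
  using assms(1) unfolding z_def cubic_root_def by Groebner_Basis.algebra

lemma of_int_forms:
  "complex_of_int (Q_form m x y) = of_int x^2 + 9*of_int x*of_int y - 3*of_int m*of_int y^2"
  "complex_of_int (F_form m x y) = of_int x^3 - 2*of_int m*of_int x^2*of_int y
     - 9*of_int m*of_int x*of_int y^2 - of_int m*(2*of_int m + 27)*of_int y^3"
  by (simp_all add: Q_form_def F_form_def)

lemma C_solutions_iff_Q_form:
  assumes "m \<noteq> 0"
  shows "(x, y) \<in> C_solutions m n \<longleftrightarrow>
    coprime x y \<and> (x, y) \<noteq> (-1, 0) \<and> y \<ge> 0 \<and> F_form m x y \<noteq> 0 \<and>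
    n * (F_form m x y)^2 = m * (Q_form m x y)^3"
  using C_solutions_iff[OF assms] by (simp add: Q_form_def)

text \<open>Scaling \<open>z\<close> by \<open>c\<close> changes the coefficients \<open>m*Q\<close>
  and \<open>m*F\<close> of its cubic into \<open>m*c^2*Q\<close> and \<open>m*c^3*F\<close>. For
  \<open>c = Q/F\<close> both equal \<open>m*Q^3/F^2\<close>, which is \<open>n\<close>.\<close>

lemma solution_root_is_root:
  assumes "m \<noteq> 0" "cubic_root m t" "(x, y) \<in> C_solutions m n"
  shows "cubic_root n (solution_root m t (x, y))"
proof -
  define z where "z = of_int x * t + of_int y * (3*t^2 + 2 * of_int m)"
  have F: "F_form m x y \<noteq> 0" and eq: "n * (F_form m x y)^2 = m * (Q_form m x y)^3"
    using assms by (auto simp: C_solutions_iff_Q_form)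
  define f q where "f = complex_of_int (F_form m x y)" and "q = complex_of_int (Q_form m x y)"
  have f: "f \<noteq> 0" using F by (simp add: f_def)
  have eq': "of_int n * f^2 = of_int m * q^3"
    using arg_cong[OF eq, of complex_of_int] by (simp add: f_def q_def)
  have z: "z^3 + of_int m * q * z + of_int m * f = 0"
    using traceless_cubic[OF assms(2), of "of_int x" "of_int y"]
    unfolding f_def q_def of_int_forms z_def by simp
  define c where "c = q / f"
  have c: "c * f = q" using f by (simp add: c_def)
  have "f^2 * (of_int n - of_int m * c^3 * f) = 0"
    using eq' by (simp add: c[symmetric] algebra_simps power2_eq_square power3_eq_cube)
  hence "of_int n = of_int m * c^3 * f" using f by simp
  hence "(c*z)^3 + of_int n * (c*z) + of_int n = 0"
    using c z by Groebner_Basis.algebra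
  thus ?thesis
    by (simp add: cubic_root_def solution_root_def z_def c_def f_def q_def)
qed

text \<open>Equal roots have proportional coordinates in the trace basis. Proportional coprime pairs
  agree up to sign, and the sign is fixed by \<open>y \<ge> 0\<close> and, for \<open>y = 0\<close>,
  by excluding \<open>(-1, 0)\<close>.\<close>

lemma solution_root_inj:
  assumes "m \<noteq> 0" "n \<noteq> 0" "no_rational_root m" "cubic_root m t"
  shows "inj_on (solution_root m t) (C_solutions m n)"
proof (rule inj_onI, clarify)
  fix x y x' y'
  assume s: "(x, y) \<in> C_solutions m n" and s': "(x', y') \<in> C_solutions m n"
    and eq: "solution_root m t (x, y) = solution_root m t (x', y')"
  define c c' where "c = complex_of_int (Q_form m x y) / of_int (F_form m x y)"
    and "c' = complex_of_int (Q_form m x' y') / of_int (F_form m x' y')"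
  \<comment> \<open>\<open>Q = 0\<close> would give \<open>n * F^2 = 0\<close>, although
    \<open>n\<close> and \<open>F\<close> are nonzero.\<close>
  have "c \<noteq> 0" using s assms(1,2) by (auto simp: c_def C_solutions_iff_Q_form)
  have "c' \<noteq> 0" using s' assms(1,2) by (auto simp: c'_def C_solutions_iff_Q_form)
  have rat: "c \<in> \<rat>" "c' \<in> \<rat>" by (simp_all add: c_def c'_def)
  have "0 + ((c * of_int x - c' * of_int x') * t
      + (c * of_int y - c' * of_int y') * (3*t^2 + 2 * of_int m)) = 0"
    using eq unfolding solution_root_def prod.case c_def[symmetric] c'_def[symmetric]
    by Groebner_Basis.algebra
  hence "c * of_int x - c' * of_int x' = 0 \<and> c * of_int y - c' * of_int y' = 0"
    using trace_basis_independent[OF assms(3,4), of 0 "c * of_int x - c' * of_int x'"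
      "c * of_int y - c' * of_int y'"] rat by simp
  hence "c * c' * (of_int x * of_int y' - of_int x' * of_int y) = 0" by Groebner_Basis.algebra
  hence "complex_of_int (x * y') = of_int (x' * y)"
    using \<open>c \<noteq> 0\<close> \<open>c' \<noteq> 0\<close> by simp
  hence cross: "x * y' = x' * y" by (simp only: of_int_eq_iff)
  have cop: "coprime x y" "coprime x' y'" "y \<ge> 0" "y' \<ge> 0" "(x, y) \<noteq> (-1, 0)" "(x', y') \<noteq> (-1, 0)"
    using s s' assms(1) by (auto simp: C_solutions_iff_Q_form)
  have "\<bar>x\<bar> * \<bar>y'\<bar> = \<bar>x'\<bar> * \<bar>y\<bar>" using cross by (metis abs_mult)
  hence "\<bar>y\<bar> = \<bar>y'\<bar>" "\<bar>x\<bar> = \<bar>x'\<bar>"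
    using coprime_crossproduct_int[OF cop(1,2)] by auto
  hence y: "y = y'" using cop by simp
  show "x = x' \<and> y = y'"
  proof (cases "y = 0")
    case True
    hence "\<bar>x\<bar> = 1" "\<bar>x'\<bar> = 1" using cop y by auto
    thus ?thesis using cop y True by (auto simp: abs_if split: if_splits)
  next
    case False
    thus ?thesis using cross y by simp
  qed
qed

text \<open>Split \<open>z\<close> into its rational part \<open>e\<close> and a traceless part
  \<open>w\<close>, and compare coefficients in the cubic equation for \<open>z\<close>. This gives
  \<open>e = 0\<close> and \<open>n = m*q = m*f\<close>; writing \<open>(x, y)\<close> as
  \<open>c\<close> times a primitive pair then yields \<open>Q = c*F\<close> and the equation for
  that pair.\<close>

lemma root_from_solution:
  assumes m: "m \<noteq> 0" "n \<noteq> 0" and irr: "no_rational_root m" "no_rational_root n"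
    and t: "cubic_root m t" and z: "z \<in> quadratic_span t" "cubic_root n z"
  shows "z \<in> solution_root m t ` C_solutions m n"
proof -
  obtain e x y where exy: "e \<in> \<rat>" "x \<in> \<rat>" "y \<in> \<rat>" "z = e + (x*t + y*(3*t^2 + 2 * of_int m))"
    using z(1) by (rule quadratic_span_traceE[where m = m])
  let ?m = "complex_of_int m" and ?n = "complex_of_int n"
  define q f where "q = x^2 + 9*x*y - 3*?m*y^2"
    and "f = x^3 - 2*?m*x^2*y - 9*?m*x*y^2 - ?m*(2*?m + 27)*y^3"
  have rat: "q \<in> \<rat>" "f \<in> \<rat>" using exy(1-3) by (simp_all add: q_def f_def)
  \<comment> \<open>The coefficients of \<open>t\<close>, \<open>t^2\<close> and \<open>1\<close> in
    the second cubic at \<open>e + w\<close>, after \<open>w^3\<close> has been replaced by means of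
    its own cubic.\<close>
  define g1 g2 g0 where "g1 = 3*e^2*x + 3*e*(-2*?m*x*y - 9*?m*y^2) - ?m*q*x + ?n*x"
    and "g2 = 9*e^2*y + 3*e*(x^2 + 3*?m*y^2) - 3*?m*q*y + 3*?n*y"
    and "g0 = e^3 + 6*?m*e^2*y + 3*e*(4*?m^2*y^2 - 6*?m*x*y) - 2*?m^2*q*y - ?m*f + ?n*(e + 2*?m*y) + ?n"
  define w where "w = x*t + y*(3*t^2 + 2*?m)"
  have w3: "w^3 + ?m*q*w + ?m*f = 0"
    unfolding w_def q_def f_def by (rule traceless_cubic[OF t])
  have w2: "w^2 = (4*?m^2*y^2 - 6*?m*x*y) + (-2*?m*x*y - 9*?m*y^2)*t + (x^2 + 3*?m*y^2)*t^2"
    using t unfolding w_def cubic_root_def by Groebner_Basis.algebra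
  have "(e + w)^3 + ?n*(e + w) + ?n = 0"
    using z(2) unfolding cubic_root_def exy(4) w_def .
  hence "e^3 + 3*e^2*w + 3*e*w^2 - ?m*q*w - ?m*f + ?n*(e + w) + ?n = 0"
    using w3 by Groebner_Basis.algebra
  hence "g0 + g1*t + g2*t^2 = 0"
    unfolding w2 unfolding w_def g0_def g1_def g2_def by Groebner_Basis.algebra
  moreover have "g0 \<in> \<rat>" "g1 \<in> \<rat>" "g2 \<in> \<rat>" using exy(1-3) rat by (simp_all add: g0_def g1_def g2_def)
  ultimately have g: "g0 = 0" "g1 = 0" "g2 = 0"
    using rational_independent[OF irr(1) t, of g0 g1 g2] by auto
  have nz: "x \<noteq> 0 \<or> y \<noteq> 0"
    using exy z(2) irr(2) by (auto simp: no_rational_root_def)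
  \<comment> \<open>The left side is \<open>x*g2 - 3*y*g1\<close>, so the nonvanishing of the index
    form gives \<open>e = 0\<close>.\<close>
  have "3 * e * (x^3 + 9*?m*x*y^2 + 27*?m*y^3) = 0"
    using g unfolding g1_def g2_def by Groebner_Basis.algebra
  hence e: "e = 0" using trace_form_nonzero[OF irr(1) exy(2,3)] nz by auto
  have "x * (?n - ?m*q) = 0" "y * (?n - ?m*q) = 0"
    using g e unfolding g1_def g2_def by simp_all
  hence nq: "?n = ?m*q" using nz by auto
  have nf: "?n = ?m*f" using g(1) e nq unfolding g0_def by Groebner_Basis.algebra
  obtain c :: complex and I J :: int where c: "c \<in> \<rat>" "x = c * of_int I" "y = c * of_int J"
    and IJ: "coprime I J" "J \<ge> 0" "(I, J) \<noteq> (-1, 0)"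
    using primitive_integer_pair[OF exy(2,3) nz] by blast
  define F where "F = complex_of_int (F_form m I J)"
  define Q where "Q = complex_of_int (Q_form m I J)"
  have fF: "f = c^3 * F" unfolding f_def F_def of_int_forms c by Groebner_Basis.algebra
  have qQ: "q = c^2 * Q" unfolding q_def Q_def of_int_forms c by Groebner_Basis.algebra
  have "c \<noteq> 0" using nz c by auto
  have "F \<noteq> 0" using nf fF m by auto
  have "?m * c^2 * (Q - c*F) = 0" using nq nf fF qQ by Groebner_Basis.algebra
  hence Q: "Q = c * F" using m \<open>c \<noteq> 0\<close> by simp
  have "?n * F^2 = ?m * Q^3" using nq qQ Q by Groebner_Basis.algebra
  hence "complex_of_int (n * (F_form m I J)^2) = of_int (m * (Q_form m I J)^3)"
    by (simp add: F_def Q_def)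
  hence "n * (F_form m I J)^2 = m * (Q_form m I J)^3" by (simp only: of_int_eq_iff)
  moreover have "F_form m I J \<noteq> 0" using \<open>F \<noteq> 0\<close> by (simp add: F_def)
  ultimately have "(I, J) \<in> C_solutions m n" using IJ m by (simp add: C_solutions_iff_Q_form)
  moreover have "solution_root m t (I, J) = z"
  proof -
    have QF: "Q / F = c" using Q \<open>F \<noteq> 0\<close> by simp
    show ?thesis unfolding exy(4) e c solution_root_def prod.case F_def[symmetric] Q_def[symmetric] QF
      by (simp add: algebra_simps)
  qed
  ultimately show ?thesis by force
qed

lemma solution_root_bij:
  assumes "m \<noteq> 0" "n \<noteq> 0" "no_rational_root m" "no_rational_root n" "cubic_root m t"
  shows "bij_betw (solution_root m t) (C_solutions m n) {z \<in> quadratic_span t. cubic_root n z}"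
proof -
  note nf = complex_subfieldD[OF complex_subfield_quadratic_span[OF assms(3,5)]]
  have "solution_root m t s \<in> quadratic_span t" for s
    unfolding solution_root_def case_prod_beta
    by (intro nf(2-8) generator_in_quadratic_span; intro nf(1); simp)
  thus ?thesis
    using solution_root_inj[OF assms(1,2,3,5)] root_from_solution[OF assms]
      solution_root_is_root[OF assms(1,5)] unfolding bij_betw_def by fast
qed

lemma root_triple_extend:
  assumes "cubic_root m t" "cubic_root m u" "t \<noteq> u"
  obtains v where "root_triple m t u v"
proof -
  obtain r1 r2 r3 where r: "root_triple m r1 r2 r3" by (rule root_triple_exists)
  hence "t = r1 \<or> t = r2 \<or> t = r3" "u = r1 \<or> u = r2 \<or> u = r3"
    using assms root_triple_iff by blast+
  thus ?thesis using that r root_triple_swap[OF r] assms(3) by (elim disjE) simp_all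
qed

section \<open>The reducible case and its splitting field\<close>

text \<open>A rational root is an integer \<open>r\<close>. Adding 1 to the cubic equation makes
  \<open>r + 1\<close> a factor of 1, so \<open>r\<close> is 0 or -2; the first gives
  \<open>m = 0\<close>, the second \<open>m = -8\<close>.\<close>

lemma rational_root_imp_minus_8:
  assumes "m \<noteq> 0" "\<not> no_rational_root m"
  shows "m = -8"
proof -
  obtain q where q: "q \<in> \<rat>" "cubic_root m q" using assms by (auto simp: no_rational_root_def)
  obtain c :: complex and r s :: int where *: "c \<in> \<rat>" "q = c * of_int r" "1 = c * of_int s" "coprime r s" "s \<ge> 0"
    using primitive_integer_pair[of q 1, OF q(1)] by (metis Rats_1 zero_neq_one)
  have "complex_of_int (r^3 + m*r*s^2 + m*s^3) = 0"
    using q(2) *(2,3) unfolding cubic_root_def by simp Groebner_Basis.algebra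
  hence eq: "r^3 + m*r*s^2 + m*s^3 = 0" by (simp only: of_int_eq_0_iff)
  hence "r^3 = s * (- m*r*s - m*s^2)" by Groebner_Basis.algebra
  hence "s dvd r^3" by simp
  moreover have "coprime (r^3) s" using *(4) by simp
  ultimately have "is_unit s" by (metis coprime_common_divisor dvd_refl)
  hence s: "s = 1" using *(5) by (simp add: abs_if split: if_splits)
  have "1 = (r + 1) * (r^2 - r + 1 + m)" using eq s by Groebner_Basis.algebra
  hence "r + 1 dvd 1" by (metis dvd_triv_left)
  hence "r = 0 \<or> r = -2" by (auto simp: abs_if split: if_splits)
  thus ?thesis using eq s assms(1) by auto
qed

definition sqrt5 :: complex where "sqrt5 = of_real (sqrt 5)"

lemma sqrt5_mult: "sqrt5 * sqrt5 = 5" "sqrt5 * (sqrt5 * x) = 5 * x"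
  by (simp_all add: sqrt5_def flip: of_real_mult mult.assoc)

lemma sqrt5_independent:
  assumes "a \<in> \<rat>" "b \<in> \<rat>" "a^2 = 5 * b^2"
  shows "a = (0::complex) \<and> b = 0"
proof (rule ccontr)
  assume "\<not> ?thesis"
  hence "a \<noteq> 0 \<or> b \<noteq> 0" by auto
  then obtain c :: complex and r s :: int where *: "a = c * of_int r" "b = c * of_int s" "coprime r s"
    using primitive_integer_pair[OF assms(1,2)] by metis
  have "c \<noteq> 0" using * \<open>a \<noteq> 0 \<or> b \<noteq> 0\<close> by auto
  have "c^2 * (of_int r^2 - 5 * of_int s^2) = 0" using assms(3) unfolding * by Groebner_Basis.algebra
  hence "complex_of_int (r^2) = of_int (5 * s^2)" using \<open>c \<noteq> 0\<close> by simp
  hence "r^2 = 5 * s^2" by (simp only: of_int_eq_iff)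
  hence "r = 0 \<and> s = 0" by (rule five_times_square)
  thus False using *(3) by simp
qed

definition sqrt5_span :: "complex set" where
  "sqrt5_span = {a + b * sqrt5 |a b. a \<in> \<rat> \<and> b \<in> \<rat>}"

lemma sqrt5_spanI: "a \<in> \<rat> \<Longrightarrow> b \<in> \<rat> \<Longrightarrow> a + b * sqrt5 \<in> sqrt5_span"
  unfolding sqrt5_span_def by blast

lemma sqrt5_spanE:
  assumes "z \<in> sqrt5_span" obtains a b where "a \<in> \<rat>" "b \<in> \<rat>" "z = a + b * sqrt5"
  using assms unfolding sqrt5_span_def by blast

lemma complex_subfield_sqrt5_span: "complex_subfield sqrt5_span"
  unfolding complex_subfield_def
proof (intro conjI ballI impI subsetI)
  fix q :: complex assume "q \<in> \<rat>"
  thus "q \<in> sqrt5_span" using sqrt5_spanI[of q 0] by simp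
next
  fix x y assume x: "x \<in> sqrt5_span" and y: "y \<in> sqrt5_span"
  obtain a b where ab: "a \<in> \<rat>" "b \<in> \<rat>" "x = a + b * sqrt5" using x by (rule sqrt5_spanE)
  obtain c d where cd: "c \<in> \<rat>" "d \<in> \<rat>" "y = c + d * sqrt5" using y by (rule sqrt5_spanE)
  have "x + y = (a + c) + (b + d) * sqrt5" using ab cd by (simp add: algebra_simps)
  thus "x + y \<in> sqrt5_span" using ab cd by (simp only:) (intro sqrt5_spanI Rats_add)
  have "x * y = (a*c + 5*b*d) + (a*d + b*c) * sqrt5"
    unfolding ab(3) cd(3) by (simp add: algebra_simps sqrt5_mult)
  thus "x * y \<in> sqrt5_span" using ab(1,2) cd(1,2) by (simp only:) (intro sqrt5_spanI; simp)
next
  fix x assume x: "x \<in> sqrt5_span" "x \<noteq> 0"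
  obtain a b where ab: "a \<in> \<rat>" "b \<in> \<rat>" "x = a + b * sqrt5" using x(1) by (rule sqrt5_spanE)
  define N where "N = a^2 - 5*b^2"
  have "N \<noteq> 0" using sqrt5_independent[OF ab(1,2)] ab x(2) by (auto simp: N_def)
  have "N \<in> \<rat>" using ab by (simp add: N_def)
  have "x * (a - b * sqrt5) = N"
    unfolding ab(3) N_def by (simp add: algebra_simps power2_eq_square sqrt5_mult)
  hence "inverse x = (a - b * sqrt5) / N" using \<open>N \<noteq> 0\<close> x(2) by (simp add: field_simps)
  hence "inverse x = a / N + (- b / N) * sqrt5" by (simp add: diff_divide_distrib)
  thus "inverse x \<in> sqrt5_span" using ab(1,2) \<open>N \<in> \<rat>\<close> by (simp only:) (intro sqrt5_spanI; simp)
qed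

lemma splitting_field_reducible: "splitting_field (f_poly (-8)) = sqrt5_span"
proof
  \<comment> \<open>The cubic factors as \<open>(X + 2) * (X^2 - 2*X - 4)\<close>.\<close>
  have tr: "root_triple (-8) (-2) (1 + sqrt5) (1 - sqrt5)"
    unfolding root_triple_def by (simp add: algebra_simps sqrt5_mult)
  have "- 2 \<in> sqrt5_span" "1 + sqrt5 \<in> sqrt5_span" "1 - sqrt5 \<in> sqrt5_span"
    using sqrt5_spanI[of "-2" 0] sqrt5_spanI[of 1 1] sqrt5_spanI[of 1 "-1"] by simp_all
  thus "splitting_field (f_poly (-8)) \<subseteq> sqrt5_span"
    using root_triple_iff[OF tr] by (intro splitting_field_subset[OF complex_subfield_sqrt5_span]) auto
  note nf = complex_subfieldD[OF complex_subfield_splitting_field[of "f_poly (-8)"]]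
  have "1 + sqrt5 \<in> splitting_field (f_poly (-8))"
    using root_triple_iff[OF tr] by (intro root_in_splitting_field) simp
  hence "(1 + sqrt5) - 1 \<in> splitting_field (f_poly (-8))" by (rule nf(5)) (simp add: nf(1))
  hence "sqrt5 \<in> splitting_field (f_poly (-8))" by simp
  thus "sqrt5_span \<subseteq> splitting_field (f_poly (-8))"
    using nf(1-3) by (auto elim!: sqrt5_spanE)
qed

text \<open>Every element \<open>a + b * sqrt5\<close> satisfies a monic quadratic equation over
  \<rat>, which a root of an irreducible cubic cannot. So reducibility passes between cubics with
  the same splitting field.\<close>

lemma rational_root_if_sqrt5_splitting_field:
  assumes "splitting_field (f_poly n) = splitting_field (f_poly (-8))"
  shows "\<not> no_rational_root n"
proof
  assume irr: "no_rational_root n"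
  obtain t u v where "root_triple n t u v" by (rule root_triple_exists)
  hence t: "cubic_root n t" using root_triple_iff by blast
  hence "t \<in> sqrt5_span" using root_in_splitting_field assms splitting_field_reducible by auto
  then obtain a b where ab: "a \<in> \<rat>" "b \<in> \<rat>" "t = a + b * sqrt5" by (rule sqrt5_spanE)
  have "(a^2 - 5*b^2) + (-2*a)*t + 1*t^2 = 0"
    unfolding ab(3) by (simp add: algebra_simps power2_eq_square sqrt5_mult)
  thus False using rational_independent[OF irr t, of "a^2 - 5*b^2" "-2*a" 1] ab by simp
qed

section \<open>The splitting field as a quadratic extension of \<rat>(t)\<close>

definition two_step_span :: "complex \<Rightarrow> complex \<Rightarrow> complex set" where
  "two_step_span t u = {x + y*u |x y. x \<in> quadratic_span t \<and> y \<in> quadratic_span t}"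

lemma two_step_spanI: "x \<in> quadratic_span t \<Longrightarrow> y \<in> quadratic_span t \<Longrightarrow> x + y*u \<in> two_step_span t u"
  unfolding two_step_span_def by blast

lemma two_step_spanE:
  assumes "z \<in> two_step_span t u"
  obtains x y where "x \<in> quadratic_span t" "y \<in> quadratic_span t" "z = x + y*u"
  using assms unfolding two_step_span_def by blast

lemma two_step_independent:
  assumes "complex_subfield S" "u \<notin> S" "x \<in> S" "y \<in> S" "x + y*u = 0"
  shows "x = 0 \<and> y = 0"
proof -
  note nf = complex_subfieldD[OF assms(1)]
  have "y = 0"
  proof (rule ccontr)
    assume "y \<noteq> 0"
    hence "u = - x / y" using assms(5) by (simp add: field_simps add_eq_0_iff)
    thus False using assms nf by metis
  qed
  thus ?thesis using assms by simp
qed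

text \<open>Here \<open>u\<close> is a root of \<open>X^2 + t*X + t^2 + m\<close>, the quotient of
  the cubic by \<open>X - t\<close>.\<close>

lemma two_step_mult:
  assumes "root_triple m t u v"
  shows "(x + y*u) * (z + w*u) = (x*z - y*w*(t^2 + of_int m)) + (x*w + y*z - y*w*t) * u"
  using assms unfolding root_triple_def by Groebner_Basis.algebra

lemma not_in_span_swap:
  assumes "no_rational_root m" "root_triple m t u v" "u \<notin> quadratic_span t"
  shows "v \<notin> quadratic_span t"
proof
  assume v: "v \<in> quadratic_span t"
  have t: "cubic_root m t" using root_triple_iff[OF assms(2)] by simp
  note nf = complex_subfieldD[OF complex_subfield_quadratic_span[OF assms(1) t]]
  have "u = - t - v" using assms(2) unfolding root_triple_def by Groebner_Basis.algebra
  thus False using nf(4,5) v generator_in_quadratic_span assms(3) by metis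
qed

text \<open>Conjugation over \<rat>(t) exchanges \<open>u\<close> and \<open>v\<close>, so the
  inverse of \<open>x + y*u\<close> is \<open>x + y*v\<close> divided by the relative norm
  \<open>N\<close>. The conjugate is nonzero because \<open>v\<close> is outside \<rat>(t)
  too.\<close>

lemma complex_subfield_two_step_span:
  assumes irr: "no_rational_root m" and tr: "root_triple m t u v" and u: "u \<notin> quadratic_span t"
  shows "complex_subfield (two_step_span t u)"
  unfolding complex_subfield_def
proof (intro conjI ballI impI subsetI)
  have t: "cubic_root m t" using root_triple_iff[OF tr] by simp
  note L = complex_subfield_quadratic_span[OF irr t]
  note nf = complex_subfieldD[OF L]
  have tL: "t \<in> quadratic_span t" by (rule generator_in_quadratic_span)
  have mL: "of_int m \<in> quadratic_span t" by (simp add: nf(1))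
  {
    fix q :: complex assume "q \<in> \<rat>"
    thus "q \<in> two_step_span t u" using two_step_spanI[of q t 0 u] nf(1) by simp
  next
    fix a b assume a: "a \<in> two_step_span t u" and b: "b \<in> two_step_span t u"
    obtain x y where xy: "x \<in> quadratic_span t" "y \<in> quadratic_span t" "a = x + y*u"
      using a by (rule two_step_spanE)
    obtain z w where zw: "z \<in> quadratic_span t" "w \<in> quadratic_span t" "b = z + w*u"
      using b by (rule two_step_spanE)
    have "a + b = (x + z) + (y + w)*u" using xy zw by (simp add: algebra_simps)
    thus "a + b \<in> two_step_span t u" using xy zw nf by (simp only:) (intro two_step_spanI nf(2))
    show "a * b \<in> two_step_span t u"
      unfolding xy(3) zw(3) two_step_mult[OF tr]
      using xy(1,2) zw(1,2) tL mL by (intro two_step_spanI nf(2-8))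
  next
    fix a assume a: "a \<in> two_step_span t u" "a \<noteq> 0"
    obtain x y where xy: "x \<in> quadratic_span t" "y \<in> quadratic_span t" "a = x + y*u"
      using a(1) by (rule two_step_spanE)
    define N where "N = x^2 - x*y*t + y^2*(t^2 + of_int m)"
    have N: "a * (x + y*v) = N"
      using tr unfolding root_triple_def N_def xy(3) by Groebner_Basis.algebra
    have NL: "N \<in> quadratic_span t" unfolding N_def using xy(1,2) tL mL by (intro nf(2-8))
    have "x + y*v \<noteq> 0"
      using two_step_independent[OF L not_in_span_swap[OF irr tr u] xy(1,2)] xy(3) a(2) by auto
    hence "N \<noteq> 0" using N a(2) by auto
    have "inverse a = (x + y*v) / N" using N \<open>N \<noteq> 0\<close> a(2) by (simp add: field_simps)
    also have "x + y*v = (x - y*t) + (- y)*u"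
      using tr unfolding root_triple_def by Groebner_Basis.algebra
    also have "\<dots> / N = (x - y*t) / N + (- y / N) * u" by (simp add: diff_divide_distrib)
    also have "\<dots> \<in> two_step_span t u"
      using xy(1,2) tL NL by (intro two_step_spanI nf(2-8))
    finally show "inverse a \<in> two_step_span t u" .
  }
qed

lemma splitting_field_cyclic:
  assumes "no_rational_root m" "root_triple m t u v" "u \<in> quadratic_span t"
  shows "splitting_field (f_poly m) = quadratic_span t"
proof
  have t: "cubic_root m t" using root_triple_iff[OF assms(2)] by simp
  note L = complex_subfield_quadratic_span[OF assms(1) t]
  have "v = - t - u" using assms(2) unfolding root_triple_def by Groebner_Basis.algebra
  hence "v \<in> quadratic_span t"
    using complex_subfieldD(4,5)[OF L] assms(3) generator_in_quadratic_span by metis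
  thus "splitting_field (f_poly m) \<subseteq> quadratic_span t"
    using assms(3) generator_in_quadratic_span root_triple_iff[OF assms(2)]
    by (intro splitting_field_subset[OF L]) auto
  show "quadratic_span t \<subseteq> splitting_field (f_poly m)"
    by (rule quadratic_span_subset[OF complex_subfield_splitting_field root_in_splitting_field[OF t]])
qed

lemma splitting_field_two_step:
  assumes "no_rational_root m" "root_triple m t u v" "u \<notin> quadratic_span t"
  shows "splitting_field (f_poly m) = two_step_span t u"
proof
  have t: "cubic_root m t" and u: "cubic_root m u" using root_triple_iff[OF assms(2)] by simp_all
  note K = complex_subfield_two_step_span[OF assms]
  note L = complex_subfield_quadratic_span[OF assms(1) t]
  have tK: "t \<in> two_step_span t u"
    using two_step_spanI[OF generator_in_quadratic_span complex_subfieldD(1)[OF L, of 0]] by simp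
  have uK: "u \<in> two_step_span t u"
    using two_step_spanI[OF complex_subfieldD(1)[OF L, of 0] complex_subfieldD(1)[OF L, of 1]] by simp
  have "v = - t - u" using assms(2) unfolding root_triple_def by Groebner_Basis.algebra
  hence "v \<in> two_step_span t u" using complex_subfieldD(4,5)[OF K] tK uK by metis
  thus "splitting_field (f_poly m) \<subseteq> two_step_span t u"
    using tK uK root_triple_iff[OF assms(2)] by (intro splitting_field_subset[OF K]) auto
  note nf = complex_subfieldD[OF complex_subfield_splitting_field[of "f_poly m"]]
  have "quadratic_span t \<subseteq> splitting_field (f_poly m)"
    by (rule quadratic_span_subset[OF complex_subfield_splitting_field root_in_splitting_field[OF t]])
  thus "two_step_span t u \<subseteq> splitting_field (f_poly m)"
    using root_in_splitting_field[OF u] by (auto elim!: two_step_spanE intro!: nf(2,3))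
qed

text \<open>If \<open>x + y u\<close> is a root of the second cubic, so is its conjugate \<open>x + y v\<close> over \<open>\<rat>(t)\<close>; either
  the two agree, or the third root is fixed by the conjugation.\<close>

lemma root_in_cubic_subfield:
  assumes irr: "no_rational_root m" and tr: "root_triple m t u v" and m: "m \<noteq> 0"
    and u: "u \<notin> quadratic_span t" and b: "cubic_root n b" "b \<in> two_step_span t u"
  shows "\<exists>z \<in> quadratic_span t. cubic_root n z"
proof -
  have t: "cubic_root m t" using root_triple_iff[OF tr] by simp
  note L = complex_subfield_quadratic_span[OF irr t]
  note nf = complex_subfieldD[OF L]
  have tL: "t \<in> quadratic_span t" by (rule generator_in_quadratic_span)
  have iL: "of_int k \<in> quadratic_span t" "numeral j \<in> quadratic_span t" for k j by (simp_all add: nf(1))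
  obtain x y where xy: "x \<in> quadratic_span t" "y \<in> quadratic_span t" "b = x + y*u"
    using b(2) by (rule two_step_spanE)
  let ?m = "complex_of_int m" and ?n = "complex_of_int n"
  \<comment> \<open>The coordinates over \<rat>(t) of the second cubic evaluated at
    \<open>x + y*u\<close>; the same \<open>p\<close> and \<open>q\<close> serve for
    \<open>v\<close> in place of \<open>u\<close>.\<close>
  define p q where "p = x^3 - 3*x*y^2*(t^2 + ?m) - ?m*y^3 + ?n*x + ?n"
    and "q = 3*x^2*y - 3*x*y^2*t - ?m*y^3 + ?n*y"
  have "p + q*u = b^3 + ?n*b + ?n"
    using tr unfolding root_triple_def p_def q_def xy(3) by Groebner_Basis.algebra
  hence "p + q*u = 0" using b(1) by (simp add: cubic_root_def)
  moreover have "p \<in> quadratic_span t" "q \<in> quadratic_span t"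
    unfolding p_def q_def using xy(1,2) tL iL by (intro nf(2-8); simp)+
  ultimately have "p = 0 \<and> q = 0" by (intro two_step_independent[OF L u])
  hence "p + q*v = 0" by simp
  moreover have "p + q*v = (x + y*v)^3 + ?n*(x + y*v) + ?n"
    using tr unfolding root_triple_def p_def q_def by Groebner_Basis.algebra
  ultimately have b': "cubic_root n (x + y*v)" by (simp add: cubic_root_def)
  show ?thesis
  proof (cases "y = 0")
    case True
    thus ?thesis using b(1) xy by auto
  next
    case False
    hence ne: "x + y*v \<noteq> b" using xy(3) root_triple_distinct[OF tr m] by simp
    obtain c where c: "root_triple n b (x + y*v) c"
      using root_triple_extend[OF b(1) b'] ne by metis
    hence "c = - (b + (x + y*v))" unfolding root_triple_def by Groebner_Basis.algebra
    also have "\<dots> = y*t - 2*x" using tr unfolding root_triple_def xy(3) by Groebner_Basis.algebra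
    finally have "c \<in> quadratic_span t" using xy(1,2) tL iL by (simp only:) (intro nf(2-8); simp)
    thus ?thesis using root_triple_iff[OF c] by auto
  qed
qed

section \<open>Counting the roots of the second cubic in \<rat>(t)\<close>

text \<open>Two roots in \<rat>(t) would bring in the third, as their sum is zero, and hence the
  whole common splitting field; but \<open>u\<close> lies outside \<rat>(t).\<close>

lemma unique_root_noncyclic:
  assumes "m \<noteq> 0" "no_rational_root m" "root_triple m t u v" "u \<notin> quadratic_span t"
    and "splitting_field (f_poly m) = splitting_field (f_poly n)"
  shows "\<exists>z. {z \<in> quadratic_span t. cubic_root n z} = {z}"
proof -
  have t: "cubic_root m t" and u: "cubic_root m u" using root_triple_iff[OF assms(3)] by simp_all
  note L = complex_subfield_quadratic_span[OF assms(2) t]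
  obtain r1 r2 r3 where r: "root_triple n r1 r2 r3" by (rule root_triple_exists)
  hence "cubic_root n r1" using root_triple_iff by blast
  moreover from this have "r1 \<in> two_step_span t u"
    using root_in_splitting_field assms(5) splitting_field_two_step[OF assms(2-4)] by auto
  ultimately obtain z where z: "z \<in> quadratic_span t" "cubic_root n z"
    using root_in_cubic_subfield[OF assms(2,3,1,4)] by blast
  have "w = z" if w: "w \<in> quadratic_span t" "cubic_root n w" for w
  proof (rule ccontr)
    assume "w \<noteq> z"
    then obtain c where c: "root_triple n z w c"
      using root_triple_extend[OF z(2) w(2)] by metis
    hence "c = - z - w" unfolding root_triple_def by Groebner_Basis.algebra
    hence "c \<in> quadratic_span t" using complex_subfieldD(4,5)[OF L] z(1) w(1) by metis
    hence "splitting_field (f_poly n) \<subseteq> quadratic_span t"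
      using root_triple_iff[OF c] z(1) w(1) by (intro splitting_field_subset[OF L]) auto
    thus False using root_in_splitting_field[OF u] assms(4,5) by auto
  qed
  thus ?thesis using z by blast
qed

lemma card_roots_cyclic:
  assumes "n \<noteq> 0" "no_rational_root m" "root_triple m t u v" "u \<in> quadratic_span t"
    and "splitting_field (f_poly m) = splitting_field (f_poly n)"
  shows "card {z \<in> quadratic_span t. cubic_root n z} = 3"
proof -
  obtain r1 r2 r3 where r: "root_triple n r1 r2 r3" by (rule root_triple_exists)
  have "{z \<in> quadratic_span t. cubic_root n z} = {r1, r2, r3}"
    using root_in_splitting_field[of n] root_triple_iff[OF r] assms(5)
      splitting_field_cyclic[OF assms(2-4)] by auto
  thus ?thesis using root_triple_distinct[OF r assms(1)] by simp
qed

section \<open>Automorphisms and the order of the Galois group\<close>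

lemma galois_group_iff:
  "\<sigma> \<in> carrier (galois_group f) \<longleftrightarrow>
     \<sigma> \<in> extensional (splitting_field f) \<and> bij_betw \<sigma> (splitting_field f) (splitting_field f) \<and>
     (\<forall>x\<in>splitting_field f. \<forall>y\<in>splitting_field f. \<sigma> (x + y) = \<sigma> x + \<sigma> y \<and> \<sigma> (x * y) = \<sigma> x * \<sigma> y) \<and>
     (\<forall>q\<in>\<rat>. \<sigma> q = q)"
  by (auto simp: galois_group_def Let_def Bij_def ring_hom_def bij_betw_def)

lemma galois_maps_roots:
  assumes "\<sigma> \<in> carrier (galois_group (f_poly m))" "cubic_root m t"
  shows "cubic_root m (\<sigma> t)"
proof -
  let ?K = "splitting_field (f_poly m)"
  note nf = complex_subfieldD[OF complex_subfield_splitting_field[of "f_poly m"]]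
  have t: "t \<in> ?K" by (rule root_in_splitting_field[OF assms(2)])
  have i: "of_int m \<in> ?K" by (simp add: nf(1))
  have add: "\<sigma> (x + y) = \<sigma> x + \<sigma> y" and mult: "\<sigma> (x * y) = \<sigma> x * \<sigma> y" if "x \<in> ?K" "y \<in> ?K" for x y
    using assms(1) that by (auto simp: galois_group_iff)
  have rat: "\<sigma> q = q" if "q \<in> \<rat>" for q using assms(1) that by (auto simp: galois_group_iff)
  have "0 = \<sigma> (t*t*t + of_int m * t + of_int m)"
    using assms(2) rat[of 0] by (simp add: cubic_root_def power3_eq_cube)
  also have "\<dots> = \<sigma> t * \<sigma> t * \<sigma> t + of_int m * \<sigma> t + of_int m"
    using t i by (simp add: add mult nf(2,3) rat)
  finally show ?thesis by (simp add: cubic_root_def power3_eq_cube)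
qed

text \<open>An automorphism is presented by its graph, which avoids choosing coordinates for each
  element. Applied to differences, \<open>zero\<close> makes the relation both single-valued and
  injective.\<close>

lemma automorphism_from_relation:
  assumes dom: "Domain R = splitting_field f" and ran: "Range R = splitting_field f"
    and rat: "\<And>q. q \<in> \<rat> \<Longrightarrow> (q, q) \<in> R"
    and add: "\<And>x x' y y'. (x, x') \<in> R \<Longrightarrow> (y, y') \<in> R \<Longrightarrow> (x + y, x' + y') \<in> R"
    and mult: "\<And>x x' y y'. (x, x') \<in> R \<Longrightarrow> (y, y') \<in> R \<Longrightarrow> (x * y, x' * y') \<in> R"
    and zero: "\<And>x x'. (x, x') \<in> R \<Longrightarrow> x = 0 \<longleftrightarrow> x' = 0"
  shows "\<exists>\<sigma> \<in> carrier (galois_group f). \<forall>(x, x') \<in> R. \<sigma> x = x'"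
proof -
  let ?K = "splitting_field f"
  note nf = complex_subfieldD[OF complex_subfield_splitting_field[of f]]
  have inj: "x = y \<longleftrightarrow> x' = y'" if "(x, x') \<in> R" "(y, y') \<in> R" for x x' y y'
  proof -
    have "(x + (-1) * y, x' + (-1) * y') \<in> R" by (intro add mult rat that) simp
    thus ?thesis using zero[of "x + (-1) * y" "x' + (-1) * y'"] by simp
  qed
  define \<sigma> where "\<sigma> = (\<lambda>x\<in>?K. SOME x'. (x, x') \<in> R)"
  have sig: "(x, \<sigma> x) \<in> R" if "x \<in> ?K" for x
    using that dom unfolding \<sigma>_def by (auto intro: someI)
  have sig_eq: "\<sigma> x = x'" if "(x, x') \<in> R" for x x'
    using inj[OF sig that] dom that by blast
  have "bij_betw \<sigma> ?K ?K"
    unfolding bij_betw_def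
  proof
    show "inj_on \<sigma> ?K" using inj sig by (metis inj_onI)
    show "\<sigma> ` ?K = ?K"
    proof
      show "\<sigma> ` ?K \<subseteq> ?K" using sig ran by blast
      show "?K \<subseteq> \<sigma> ` ?K"
      proof
        fix y assume "y \<in> ?K"
        then obtain x where x: "(x, y) \<in> R" using ran by blast
        hence "x \<in> ?K" using dom by blast
        thus "y \<in> \<sigma> ` ?K" using sig_eq[OF x] by blast
      qed
    qed
  qed
  moreover have "\<sigma> (x + y) = \<sigma> x + \<sigma> y \<and> \<sigma> (x * y) = \<sigma> x * \<sigma> y" if "x \<in> ?K" "y \<in> ?K" for x y
    using sig_eq add mult sig that by metis
  moreover have "\<sigma> q = q" if "q \<in> \<rat>" for q using sig_eq rat that by blast
  moreover have "\<sigma> \<in> extensional ?K" by (simp add: \<sigma>_def)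
  ultimately have "\<sigma> \<in> carrier (galois_group f)" by (simp add: galois_group_iff)
  thus ?thesis using sig_eq by blast
qed

text \<open>Graph of the embedding of \<rat>(t) that sends \<open>t\<close> to
  \<open>u\<close>.\<close>

definition conjugate_pairs :: "complex \<Rightarrow> complex \<Rightarrow> (complex \<times> complex) set" where
  "conjugate_pairs t u = {(a + b*t + c*t^2, a + b*u + c*u^2) |a b c. a \<in> \<rat> \<and> b \<in> \<rat> \<and> c \<in> \<rat>}"

lemma conjugate_pairsI:
  "a \<in> \<rat> \<Longrightarrow> b \<in> \<rat> \<Longrightarrow> c \<in> \<rat> \<Longrightarrow> (a + b*t + c*t^2, a + b*u + c*u^2) \<in> conjugate_pairs t u"
  unfolding conjugate_pairs_def by blast

lemma conjugate_pairsE: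
  assumes "(x, x') \<in> conjugate_pairs t u"
  obtains a b c where "a \<in> \<rat>" "b \<in> \<rat>" "c \<in> \<rat>" "x = a + b*t + c*t^2" "x' = a + b*u + c*u^2"
  using assms unfolding conjugate_pairs_def by blast

lemma conjugate_pairs_Domain: "Domain (conjugate_pairs t u) = quadratic_span t"
  unfolding conjugate_pairs_def quadratic_span_def by blast

lemma conjugate_pairs_Range: "Range (conjugate_pairs t u) = quadratic_span u"
  unfolding conjugate_pairs_def quadratic_span_def by blast

lemma conjugate_pairs_rat: "q \<in> \<rat> \<Longrightarrow> (q, q) \<in> conjugate_pairs t u"
  using conjugate_pairsI[of q 0 0 t u] by simp

lemma conjugate_pairs_generator: "(t, u) \<in> conjugate_pairs t u"
  using conjugate_pairsI[of 0 1 0 t u] by simp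

lemma conjugate_pairs_add:
  assumes "(x, x') \<in> conjugate_pairs t u" "(y, y') \<in> conjugate_pairs t u"
  shows "(x + y, x' + y') \<in> conjugate_pairs t u"
proof -
  obtain a b c where 1: "a \<in> \<rat>" "b \<in> \<rat>" "c \<in> \<rat>" "x = a + b*t + c*t^2" "x' = a + b*u + c*u^2"
    using assms(1) by (rule conjugate_pairsE)
  obtain d e f where 2: "d \<in> \<rat>" "e \<in> \<rat>" "f \<in> \<rat>" "y = d + e*t + f*t^2" "y' = d + e*u + f*u^2"
    using assms(2) by (rule conjugate_pairsE)
  have "x + y = (a + d) + (b + e)*t + (c + f)*t^2" "x' + y' = (a + d) + (b + e)*u + (c + f)*u^2"
    using 1 2 by (simp_all add: algebra_simps)
  thus ?thesis using 1(1-3) 2(1-3) by (simp only:) (intro conjugate_pairsI Rats_add)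
qed

lemma conjugate_pairs_mult:
  assumes "cubic_root m t" "cubic_root m u"
    and "(x, x') \<in> conjugate_pairs t u" "(y, y') \<in> conjugate_pairs t u"
  shows "(x * y, x' * y') \<in> conjugate_pairs t u"
proof -
  obtain a b c where 1: "a \<in> \<rat>" "b \<in> \<rat>" "c \<in> \<rat>" "x = a + b*t + c*t^2" "x' = a + b*u + c*u^2"
    using assms(3) by (rule conjugate_pairsE)
  obtain d e f where 2: "d \<in> \<rat>" "e \<in> \<rat>" "f \<in> \<rat>" "y = d + e*t + f*t^2" "y' = d + e*u + f*u^2"
    using assms(4) by (rule conjugate_pairsE)
  show ?thesis
    unfolding 1(4,5) 2(4,5) quadratic_span_mult[OF assms(1)] quadratic_span_mult[OF assms(2)]
    using 1(1-3) 2(1-3) by (intro conjugate_pairsI) simp_all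
qed

lemma conjugate_pairs_zero:
  assumes "no_rational_root m" "cubic_root m t" "cubic_root m u" "(x, x') \<in> conjugate_pairs t u"
  shows "x = 0 \<longleftrightarrow> x' = 0"
proof -
  obtain a b c where abc: "a \<in> \<rat>" "b \<in> \<rat>" "c \<in> \<rat>" "x = a + b*t + c*t^2" "x' = a + b*u + c*u^2"
    using assms(4) by (rule conjugate_pairsE)
  thus ?thesis
    using rational_independent[OF assms(1,2) abc(1-3)] rational_independent[OF assms(1,3) abc(1-3)]
    by auto
qed

lemma cyclic_automorphism:
  assumes "no_rational_root m" "cubic_root m t" "cubic_root m u"
    and "splitting_field (f_poly m) = quadratic_span t" "splitting_field (f_poly m) = quadratic_span u"
  shows "\<exists>\<sigma> \<in> carrier (galois_group (f_poly m)). \<sigma> t = u"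
  using automorphism_from_relation[of "conjugate_pairs t u" "f_poly m"]
    conjugate_pairs_Domain[of t u] conjugate_pairs_Range[of t u] conjugate_pairs_rat[of _ t u]
    conjugate_pairs_add[of _ _ t u] conjugate_pairs_mult[OF assms(2,3)]
    conjugate_pairs_zero[OF assms(1-3)] conjugate_pairs_generator[of t u] assms(4,5)
  by fastforce

text \<open>Graph of the extension of \<open>t \<mapsto> t'\<close> that sends \<open>u\<close> to
  \<open>u'\<close>.\<close>

definition two_step_pairs ::
  "complex \<Rightarrow> complex \<Rightarrow> complex \<Rightarrow> complex \<Rightarrow> (complex \<times> complex) set" where
  "two_step_pairs t u t' u' = {(x + y*u, x' + y'*u') |x x' y y'.
     (x, x') \<in> conjugate_pairs t t' \<and> (y, y') \<in> conjugate_pairs t t'}"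

lemma two_step_pairsI:
  "(x, x') \<in> conjugate_pairs t t' \<Longrightarrow> (y, y') \<in> conjugate_pairs t t' \<Longrightarrow>
    (x + y*u, x' + y'*u') \<in> two_step_pairs t u t' u'"
  unfolding two_step_pairs_def by blast

lemma two_step_pairsE:
  assumes "(z, z') \<in> two_step_pairs t u t' u'"
  obtains x x' y y' where "(x, x') \<in> conjugate_pairs t t'" "(y, y') \<in> conjugate_pairs t t'"
    "z = x + y*u" "z' = x' + y'*u'"
  using assms unfolding two_step_pairs_def by blast

text \<open>The multiplication rule over \<rat>(t) has coefficients polynomial in \<open>t\<close>,
  and \<open>t \<mapsto> t'\<close> carries them to those for \<open>t'\<close> and
  \<open>u'\<close>. Independence over \<rat>(t) and \<rat>(t') gives the condition on zero.\<close>

lemma two_step_automorphism: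
  assumes irr: "no_rational_root m" and tr: "root_triple m t u v" "root_triple m t' u' v'"
    and u: "u \<notin> quadratic_span t" "u' \<notin> quadratic_span t'"
  shows "\<exists>\<sigma> \<in> carrier (galois_group (f_poly m)). \<sigma> t = t' \<and> \<sigma> u = u'"
proof -
  have t: "cubic_root m t" "cubic_root m t'"
    using root_triple_iff[OF tr(1)] root_triple_iff[OF tr(2)] by auto
  let ?R = "two_step_pairs t u t' u'" and ?C = "conjugate_pairs t t'"
  note C_rat = conjugate_pairs_rat[of _ t t']
  note C_add = conjugate_pairs_add[of _ _ t t']
  note C_mult = conjugate_pairs_mult[OF t]
  have C_diff: "(x - y, x' - y') \<in> ?C" if "(x, x') \<in> ?C" "(y, y') \<in> ?C" for x x' y y'
    using C_add[OF that(1) C_mult[OF C_rat[of "-1"] that(2)]] by simp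
  have C_gen: "(t, t') \<in> ?C" by (rule conjugate_pairs_generator)
  have C_w: "(t^2 + of_int m, t'^2 + of_int m) \<in> ?C"
    unfolding power2_eq_square by (intro C_add C_mult C_gen C_rat) simp
  have "Domain ?R = two_step_span t u"
    unfolding two_step_pairs_def two_step_span_def conjugate_pairs_Domain[of t t', symmetric] by blast
  hence dom: "Domain ?R = splitting_field (f_poly m)"
    using splitting_field_two_step[OF irr tr(1) u(1)] by simp
  have "Range ?R = two_step_span t' u'"
    unfolding two_step_pairs_def two_step_span_def conjugate_pairs_Range[of t t', symmetric] by blast
  hence ran: "Range ?R = splitting_field (f_poly m)"
    using splitting_field_two_step[OF irr tr(2) u(2)] by simp
  have rat: "(q, q) \<in> ?R" if "q \<in> \<rat>" for q
    using two_step_pairsI[OF C_rat[OF that] C_rat[of 0], of u u'] by simp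
  have add: "(z + w, z' + w') \<in> ?R" if zw: "(z, z') \<in> ?R" "(w, w') \<in> ?R" for z z' w w'
  proof -
    obtain x x' y y' where 1: "(x, x') \<in> ?C" "(y, y') \<in> ?C" "z = x + y*u" "z' = x' + y'*u'"
      using zw(1) by (rule two_step_pairsE)
    obtain a a' b b' where 2: "(a, a') \<in> ?C" "(b, b') \<in> ?C" "w = a + b*u" "w' = a' + b'*u'"
      using zw(2) by (rule two_step_pairsE)
    have "z + w = (x + a) + (y + b)*u" "z' + w' = (x' + a') + (y' + b')*u'"
      using 1 2 by (simp_all add: algebra_simps)
    thus ?thesis using 1(1,2) 2(1,2) by (simp only:) (intro two_step_pairsI C_add)
  qed
  have mult: "(z * w, z' * w') \<in> ?R" if zw: "(z, z') \<in> ?R" "(w, w') \<in> ?R" for z z' w w'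
  proof -
    obtain x x' y y' where 1: "(x, x') \<in> ?C" "(y, y') \<in> ?C" "z = x + y*u" "z' = x' + y'*u'"
      using zw(1) by (rule two_step_pairsE)
    obtain a a' b b' where 2: "(a, a') \<in> ?C" "(b, b') \<in> ?C" "w = a + b*u" "w' = a' + b'*u'"
      using zw(2) by (rule two_step_pairsE)
    have "(x*a - y*b*(t^2 + of_int m), x'*a' - y'*b'*(t'^2 + of_int m)) \<in> ?C"
      using 1(1,2) 2(1,2) by (intro C_diff C_mult C_w)
    moreover have "(x*b + y*a - y*b*t, x'*b' + y'*a' - y'*b'*t') \<in> ?C"
      using 1(1,2) 2(1,2) by (intro C_diff C_add C_mult C_gen)
    ultimately show ?thesis
      unfolding 1(3,4) 2(3,4) two_step_mult[OF tr(1)] two_step_mult[OF tr(2)]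
      by (rule two_step_pairsI)
  qed
  have zero: "z = 0 \<longleftrightarrow> z' = 0" if z: "(z, z') \<in> ?R" for z z'
  proof -
    obtain x x' y y' where 1: "(x, x') \<in> ?C" "(y, y') \<in> ?C" "z = x + y*u" "z' = x' + y'*u'"
      using z by (rule two_step_pairsE)
    have xy: "x \<in> quadratic_span t" "y \<in> quadratic_span t" "x' \<in> quadratic_span t'" "y' \<in> quadratic_span t'"
      using 1(1,2) conjugate_pairs_Domain[of t t'] conjugate_pairs_Range[of t t'] by blast+
    have "x = 0 \<longleftrightarrow> x' = 0" "y = 0 \<longleftrightarrow> y' = 0"
      using conjugate_pairs_zero[OF irr t] 1(1,2) by blast+
    moreover have "z = 0 \<longleftrightarrow> x = 0 \<and> y = 0"
      using two_step_independent[OF complex_subfield_quadratic_span[OF irr t(1)] u(1) xy(1,2)] 1(3) by auto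
    moreover have "z' = 0 \<longleftrightarrow> x' = 0 \<and> y' = 0"
      using two_step_independent[OF complex_subfield_quadratic_span[OF irr t(2)] u(2) xy(3,4)] 1(4) by auto
    ultimately show ?thesis by blast
  qed
  have "(t, t') \<in> ?R" using two_step_pairsI[OF C_gen C_rat[of 0], of u u'] by simp
  moreover have "(u, u') \<in> ?R" using two_step_pairsI[OF C_rat[of 0] C_rat[of 1], of u u'] by simp
  ultimately show ?thesis
    using automorphism_from_relation[OF dom ran rat add mult zero] by fast
qed

text \<open>An automorphism is determined by the image of \<open>sqrt5\<close>, whose square is
  5.\<close>

lemma card_galois_reducible: "card (carrier (galois_group (f_poly (-8)))) \<le> 2"
proof -
  let ?G = "carrier (galois_group (f_poly (-8)))"
  note K = splitting_field_reducible
  note nf = complex_subfieldD[OF complex_subfield_sqrt5_span]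
  have s: "sqrt5 \<in> sqrt5_span" using sqrt5_spanI[of 0 1] by simp
  have ev: "\<sigma> (a + b * sqrt5) = a + b * \<sigma> sqrt5" if "\<sigma> \<in> ?G" "a \<in> \<rat>" "b \<in> \<rat>" for \<sigma> a b
    using that s nf(1-3) unfolding galois_group_iff K by simp
  have "inj_on (\<lambda>\<sigma>. \<sigma> sqrt5) ?G"
  proof (rule inj_onI)
    fix \<sigma> \<tau> assume st: "\<sigma> \<in> ?G" "\<tau> \<in> ?G" "\<sigma> sqrt5 = \<tau> sqrt5"
    show "\<sigma> = \<tau>"
    proof (rule extensionalityI)
      show "\<sigma> \<in> extensional sqrt5_span" "\<tau> \<in> extensional sqrt5_span"
        using st(1,2) by (simp_all add: galois_group_iff K)
      show "\<sigma> x = \<tau> x" if "x \<in> sqrt5_span" for x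
        using that ev[OF st(1)] ev[OF st(2)] st(3) by (auto elim!: sqrt5_spanE)
    qed
  qed
  moreover have "(\<lambda>\<sigma>. \<sigma> sqrt5) ` ?G \<subseteq> {sqrt5, - sqrt5}"
  proof (rule image_subsetI)
    fix \<sigma> assume sig: "\<sigma> \<in> ?G"
    have "\<sigma> sqrt5 * \<sigma> sqrt5 = \<sigma> (sqrt5 * sqrt5)" using sig s by (simp add: galois_group_iff K)
    also have "\<dots> = sqrt5 * sqrt5" using sig by (simp add: galois_group_iff sqrt5_mult(1))
    finally have "\<sigma> sqrt5 = sqrt5 \<or> \<sigma> sqrt5 = - sqrt5" by (simp only: square_eq_iff)
    thus "\<sigma> sqrt5 \<in> {sqrt5, - sqrt5}" by simp
  qed
  ultimately have "card ?G \<le> card {sqrt5, - sqrt5}" by (intro card_inj_on_le) auto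
  also have "\<dots> \<le> 2" by (simp add: card_insert_if)
  finally show ?thesis .
qed

text \<open>An automorphism is determined by the image of \<open>t\<close>. Each root generates the
  same field, so each of the three occurs as an image.\<close>

lemma card_galois_cyclic:
  assumes m: "m \<noteq> 0" and irr: "no_rational_root m" and sq: "- (4*m + 27) = k^2"
  shows "card (carrier (galois_group (f_poly m))) = 3"
proof -
  let ?G = "carrier (galois_group (f_poly m))"
  obtain t u v where tr: "root_triple m t u v" by (rule root_triple_exists)
  have K: "splitting_field (f_poly m) = quadratic_span z" if z: "cubic_root m z" for z
  proof -
    obtain y w where "root_triple m z y w"
      using z root_triple_iff[OF tr, of z] tr root_triple_swap[OF tr] by blast
    thus ?thesis using splitting_field_cyclic irr in_span_if_square_disc[OF m irr _ sq] by blast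
  qed
  have t: "cubic_root m t" using root_triple_iff[OF tr] by simp
  note nf = complex_subfieldD[OF complex_subfield_quadratic_span[OF irr t]]
  have tL: "t \<in> quadratic_span t" by (rule generator_in_quadratic_span)
  have ev: "\<sigma> (a + b*t + c*t^2) = a + b * \<sigma> t + c * (\<sigma> t)^2"
    if "\<sigma> \<in> ?G" "a \<in> \<rat>" "b \<in> \<rat>" "c \<in> \<rat>" for \<sigma> a b c
    using that tL nf(1-3) unfolding galois_group_iff K[OF t] power2_eq_square by simp
  have inj: "inj_on (\<lambda>\<sigma>. \<sigma> t) ?G"
  proof (rule inj_onI)
    fix \<sigma> \<tau> assume st: "\<sigma> \<in> ?G" "\<tau> \<in> ?G" "\<sigma> t = \<tau> t"
    show "\<sigma> = \<tau>"
    proof (rule extensionalityI)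
      show "\<sigma> \<in> extensional (quadratic_span t)" "\<tau> \<in> extensional (quadratic_span t)"
        using st(1,2) by (simp_all add: galois_group_iff K[OF t])
      show "\<sigma> x = \<tau> x" if "x \<in> quadratic_span t" for x
        using that ev[OF st(1)] ev[OF st(2)] st(3) by (auto elim!: quadratic_spanE)
    qed
  qed
  have "(\<lambda>\<sigma>. \<sigma> t) ` ?G = {z. cubic_root m z}"
    using galois_maps_roots t cyclic_automorphism[OF irr t _ K[OF t] K] by blast
  hence "card ?G = card {z. cubic_root m z}" using card_image[OF inj] by simp
  also have "{z. cubic_root m z} = {t, u, v}" using root_triple_iff[OF tr] by auto
  also have "card \<dots> = 3" using root_triple_distinct[OF tr m] by simp
  finally show ?thesis .
qed

text \<open>Every ordered pair of distinct roots is an image of \<open>(t, u)\<close>; four of them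
  suffice to rule out the orders 2 and 3. Finiteness is assumed since \<open>card\<close> of an
  infinite set is 0.\<close>

lemma card_galois_noncyclic:
  assumes m: "m \<noteq> 0" and irr: "no_rational_root m" and nsq: "\<nexists>k. - (4*m + 27) = k^2"
    and fin: "finite (carrier (galois_group (f_poly m)))"
  shows "card (carrier (galois_group (f_poly m))) \<ge> 4"
proof -
  let ?G = "carrier (galois_group (f_poly m))"
  obtain t u v where tr: "root_triple m t u v" by (rule root_triple_exists)
  have notin: "y \<notin> quadratic_span z" if "root_triple m z y w" for z y w
    using square_disc_if_in_span[OF m irr that] nsq by blast
  have "(z, y) \<in> (\<lambda>\<sigma>. (\<sigma> t, \<sigma> u)) ` ?G" if "root_triple m z y w" for z y w
    using two_step_automorphism[OF irr tr that notin[OF tr] notin[OF that]] by force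
  hence "{(t, u), (u, t), (t, v), (v, t)} \<subseteq> (\<lambda>\<sigma>. (\<sigma> t, \<sigma> u)) ` ?G"
    using tr root_triple_swap[OF tr] by blast
  hence "card {(t, u), (u, t), (t, v), (v, t)} \<le> card ?G"
    using fin by (rule surj_card_le[rotated])
  moreover have "card {(t, u), (u, t), (t, v), (v, t)} = 4"
    using root_triple_distinct[OF tr m] by auto
  ultimately show ?thesis by simp
qed

section \<open>From the isomorphism type to reducibility and discriminant\<close>

lemma iso_card:
  assumes "G \<cong> H" "finite (carrier H)"
  shows "finite (carrier G)" "card (carrier G) = card (carrier H)"
proof -
  obtain h where "bij_betw h (carrier G) (carrier H)"
    using assms(1) by (auto simp: is_iso_def iso_def)
  thus "finite (carrier G)" "card (carrier G) = card (carrier H)"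
    using assms(2) bij_betw_finite bij_betw_same_card by blast+
qed

lemma card_integer_mod_group: "k > 0 \<Longrightarrow>
  finite (carrier (integer_mod_group k)) \<and> card (carrier (integer_mod_group k)) = k"
  by (simp add: carrier_integer_mod_group)

lemma card_sym_group_3: "finite (carrier (sym_group 3)) \<and> card (carrier (sym_group 3)) = 6"
  by (simp add: sym_group_def card_permutations finite_permutations fact_numeral)

text \<open>The order of the group decides: it is at most 2 for a reducible cubic, 3 for an
  irreducible one with \<open>- (4*m + 27)\<close> a square, and at least 4, if finite,
  otherwise.\<close>

lemma iso_S3_imp:
  assumes "m \<noteq> 0" "galois_group (f_poly m) \<cong> sym_group 3"
  shows "no_rational_root m \<and> (\<nexists>k. - (4*m + 27) = k^2)"
proof -
  have "card (carrier (galois_group (f_poly m))) = 6"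
    using iso_card[OF assms(2)] card_sym_group_3 by simp
  moreover from this have "no_rational_root m"
    using rational_root_imp_minus_8[OF assms(1)] card_galois_reducible by fastforce
  ultimately show ?thesis using card_galois_cyclic[OF assms(1)] by fastforce
qed

lemma iso_C3_imp:
  assumes "m \<noteq> 0" "galois_group (f_poly m) \<cong> integer_mod_group 3"
  shows "no_rational_root m \<and> (\<exists>k. - (4*m + 27) = k^2)"
proof -
  have "card (carrier (galois_group (f_poly m))) = 3" "finite (carrier (galois_group (f_poly m)))"
    using iso_card[OF assms(2)] card_integer_mod_group[of 3] by simp_all
  moreover from this have "no_rational_root m"
    using rational_root_imp_minus_8[OF assms(1)] card_galois_reducible by fastforce
  ultimately show ?thesis using card_galois_noncyclic[OF assms(1)] by fastforce
qed

lemma iso_C2_imp: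
  assumes "m \<noteq> 0" "galois_group (f_poly m) \<cong> integer_mod_group 2"
  shows "m = -8"
proof -
  have "card (carrier (galois_group (f_poly m))) = 2" "finite (carrier (galois_group (f_poly m)))"
    using iso_card[OF assms(2)] card_integer_mod_group[of 2] by simp_all
  hence "\<not> no_rational_root m"
    using card_galois_cyclic[OF assms(1)] card_galois_noncyclic[OF assms(1)] by fastforce
  thus ?thesis by (rule rational_root_imp_minus_8[OF assms(1)])
qed

section \<open>The solutions for \<open>m = n\<close>, and the final count\<close>

lemma trivial_solution: "m \<noteq> 0 \<Longrightarrow> (1, 0) \<in> C_solutions m m"
  by (simp add: C_solutions_iff F_form_def)

lemma F_form_cyclic:
  fixes b :: int
  assumes "m = - (b^2) - b - 7"
  shows "F_form m (b - 4) 1 = - ((2*b + 1)^3)" "F_form m (- b - 5) 1 = (2*b + 1)^3"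
  unfolding F_form_def assms by (simp_all only: power_one mult_1_right, Groebner_Basis.algebra+)

text \<open>At both pairs \<open>Q = (2*b + 1)^2\<close>, while \<open>F\<close> is
  \<open>(2*b + 1)^3\<close> up to sign; so \<open>F^2 = Q^3\<close>, which is (C) for
  \<open>m = n\<close>.\<close>

lemma cyclic_solutions:
  fixes b :: int
  assumes "m \<noteq> 0" "m = - (b^2) - b - 7"
  shows "(b - 4, 1) \<in> C_solutions m m" "(- b - 5, 1) \<in> C_solutions m m"
proof -
  have odd: "2*b + 1 \<noteq> 0" by presburger
  have "(b - 4)^2 + 9*(b - 4)*1 - 3*m*1^2 = (2*b + 1)^2" "(- b - 5)^2 + 9*(- b - 5)*1 - 3*m*1^2 = (2*b + 1)^2"
    unfolding assms(2) by (simp_all only: power_one mult_1_right, Groebner_Basis.algebra+)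
  thus "(b - 4, 1) \<in> C_solutions m m" "(- b - 5, 1) \<in> C_solutions m m"
    unfolding C_solutions_iff[OF assms(1)] F_form_cyclic[OF assms(2)] using odd
    by (simp_all flip: power_mult)
qed

lemma C_solutions_singleton:
  assumes "m \<noteq> 0" "n \<noteq> 0" "splitting_field (f_poly m) = splitting_field (f_poly n)"
    and "no_rational_root m" "\<nexists>k. - (4*m + 27) = k^2"
  shows "\<exists>s. C_solutions m n = {s}"
proof -
  obtain t u v where tr: "root_triple m t u v" by (rule root_triple_exists)
  have t: "cubic_root m t" using root_triple_iff[OF tr] by simp
  \<comment> \<open>Otherwise \<open>n = -8\<close>, and the common splitting field would force a
    rational root of the first cubic.\<close>
  have irr: "no_rational_root n"
    using rational_root_imp_minus_8[OF assms(2)] rational_root_if_sqrt5_splitting_field[of m] assms(3,4) by metis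
  have "u \<notin> quadratic_span t" using square_disc_if_in_span[OF assms(1,4) tr] assms(5) by blast
  then obtain z where "{z \<in> quadratic_span t. cubic_root n z} = {z}"
    using unique_root_noncyclic[OF assms(1,4) tr _ assms(3)] by blast
  hence "card (C_solutions m n) = 1"
    using bij_betw_same_card[OF solution_root_bij[OF assms(1,2,4) irr t]] by simp
  thus ?thesis by (rule card_1_singletonE) blast
qed

lemma card_C_solutions_cyclic:
  assumes "m \<noteq> 0" "n \<noteq> 0" "splitting_field (f_poly m) = splitting_field (f_poly n)"
    and "no_rational_root m" "- (4*m + 27) = k^2"
  shows "card (C_solutions m n) = 3"
proof -
  obtain t u v where tr: "root_triple m t u v" by (rule root_triple_exists)
  have t: "cubic_root m t" using root_triple_iff[OF tr] by simp
  have irr: "no_rational_root n"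
    using rational_root_imp_minus_8[OF assms(2)] rational_root_if_sqrt5_splitting_field[of m] assms(3,4) by metis
  have "u \<in> quadratic_span t" by (rule in_span_if_square_disc[OF assms(1,4) tr assms(5)])
  hence "card {z \<in> quadratic_span t. cubic_root n z} = 3"
    by (rule card_roots_cyclic[OF assms(2,4) tr _ assms(3)])
  thus ?thesis using bij_betw_same_card[OF solution_root_bij[OF assms(1,2,4) irr t]] by simp
qed

lemma square_disc_param:
  fixes m k :: int
  assumes "- (4*m + 27) = k^2"
  obtains b where "m = - (b^2) - b - 7"
proof -
  have "odd (- (4*m + 27))" by presburger
  hence "odd k" unfolding assms by simp
  then obtain b where "k = 2*b + 1" by (rule oddE)
  hence "m = - (b^2) - b - 7" using assms by (simp add: power2_eq_square algebra_simps)
  thus ?thesis by (rule that)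
qed

theorem theorem3:
  fixes m n :: int
  assumes "m \<noteq> 0" and "n \<noteq> 0"
    and "splitting_field (f_poly m) = splitting_field (f_poly n)"
  shows
    "(galois_group (f_poly m) \<cong> sym_group 3 \<longrightarrow>
        (\<exists>!s. s \<in> C_solutions m n) \<and>
        (m = n \<longrightarrow> C_solutions m n = {(1, 0)})) \<and>
     (galois_group (f_poly m) \<cong> integer_mod_group 3 \<longrightarrow>
        (\<exists>b::int. m = - (b^2) - b - 7 \<and>
           card (C_solutions m n) = 3 \<and>
           (m = n \<longrightarrow>
              C_solutions m n = {(1, 0), (b - 4, 1), (- b - 5, 1)} \<and>
              F_form m 1 0 = 1 \<and>
              F_form m (b - 4) 1 = - ((2*b + 1)^3) \<and>
              F_form m (- b - 5) 1 = (2*b + 1)^3))) \<and>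
     (galois_group (f_poly m) \<cong> integer_mod_group 2 \<longrightarrow>
        m = -8 \<and> n = -8 \<and>
        C_solutions m n = {(1, 0), (-4, 1)} \<and>
        F_form m 1 0 = 1 \<and> F_form m (-4) 1 = -8)"
proof (intro conjI impI, goal_cases)
  case 1
  hence "\<exists>s. C_solutions m n = {s}" using C_solutions_singleton[OF assms] iso_S3_imp[OF assms(1)] by blast
  thus ?case by auto
next
  case 2
  hence "\<exists>s. C_solutions m n = {s}" using C_solutions_singleton[OF assms] iso_S3_imp[OF assms(1)] by blast
  thus ?case using trivial_solution[OF assms(1)] \<open>m = n\<close> by auto
next
  case 3
  then obtain k where irr: "no_rational_root m" and k: "- (4*m + 27) = k^2"
    using iso_C3_imp[OF assms(1)] by blast
  obtain b where b: "m = - (b^2) - b - 7" using k by (rule square_disc_param)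
  have card: "card (C_solutions m n) = 3" by (rule card_C_solutions_cyclic[OF assms irr k])
  have "C_solutions m n = {(1, 0), (b - 4, 1), (- b - 5, 1)}" if "m = n"
  \<comment> \<open>The three listed pairs are solutions, and the count leaves no others.\<close>
  proof (rule sym, rule card_subset_eq)
    show "finite (C_solutions m n)" using card by (intro card_ge_0_finite) simp
    show "{(1, 0), (b - 4, 1), (- b - 5, 1)} \<subseteq> C_solutions m n"
      using trivial_solution[OF assms(1)] cyclic_solutions[OF assms(1) b] that by simp
    \<comment> \<open>Equality would mean \<open>2*b = -1\<close>.\<close>
    have "b - 4 \<noteq> - b - 5" by presburger
    thus "card {(1, 0::int), (b - 4, 1), (- b - 5, 1)} = card (C_solutions m n)" by (simp add: card)
  qed
  moreover have "F_form m 1 0 = 1" by (simp add: F_form_def)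
  ultimately show ?case using b card F_form_cyclic[OF b] by blast
next
  case 4
  thus ?case by (rule iso_C2_imp[OF assms(1)])
next
  case 5
  hence "m = -8" by (rule iso_C2_imp[OF assms(1)])
  thus ?case using rational_root_imp_minus_8[OF assms(2)] rational_root_if_sqrt5_splitting_field[of n] assms(3) by metis
next
  case 6
  hence m: "m = -8" by (rule iso_C2_imp[OF assms(1)])
  hence "n = -8" using rational_root_imp_minus_8[OF assms(2)] rational_root_if_sqrt5_splitting_field[of n] assms(3) by metis
  thus ?case using m reducible_solutions by simp
next
  case 7
  show ?case by (simp add: F_form_def)
next
  case 8
  hence "m = -8" by (rule iso_C2_imp[OF assms(1)])
  thus ?case by (simp add: F_form_def)
qed

end
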